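(* The Ricci curvature of a Berwald space is an affine invariant and depends only on the induced connection: if $(M,F)$ and $(M,F')$ are affinely equivalent Berwald spaces, then $$\operatorname{Ric}_F(v)=\operatorname{Ric}_{F'}(v)$$ for all tangent vectors $v$. In particular, having non-positive, respectively non-negative, Ricci curvature is an affine invariant.
   Context: Manifolds are connected, smooth and finite-dimensional. A Finsler structure on $M$ is a function $F:TM\to[0,\infty)$, $C^\infty$ off the zero section, with $F(\lambda v)=\lambda F(v)$ for $\lambda>0$, such that for each $v\in T_xM\setminus\{0\}$ the Hessian $g_v$ of $\frac12F^2|_{T_xM}$ at $v$ is a positive definite inner product on $T_xM$. $(M,F)$ is a Berwald space if there is a (necessarily unique) torsion-free affine connection on $M$, called the induced connection, whose parallel transport along curves preserves $F$. Geodesics are the auto-parallel curves of the induced connection. Two Berwald structures on $M$ are affinely equivalent if their induced connections agree. Ricci curvature: for $v\in T_xM\setminus\{0\}$, extend $v$ to a local nowhere vanishing vector field $V$ whose integral curves are geodesics; then $\operatorname{Ric}_F(v)$ is the Ricci tensor of the Riemannian metric $g_V$ evaluated at $(v,v)$ (this is independent of the extension); $\operatorname{Ric}_F(0)=0$. Non-negative (resp. non-positive) Ricci curvature means $\operatorname{Ric}_F(v)\ge0$ (resp. $\le0$) for all $v$. *)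

theory Defs
  imports "HOL-Analysis.Analysis"
begin

section \<open>Smooth maps between Euclidean spaces\<close>

text \<open>The derivatives are unrestricted ones, so this is the usual notion for open \<open>S\<close> only.\<close>

fun Ck_on :: "nat \<Rightarrow> ('a::euclidean_space \<Rightarrow> 'b::real_normed_vector) \<Rightarrow> 'a set \<Rightarrow> bool" where
  "Ck_on 0 f S \<longleftrightarrow> continuous_on S f"
| "Ck_on (Suc k) f S \<longleftrightarrow> (\<forall>x\<in>S. f differentiable (at x)) \<and>
     (\<forall>v. Ck_on k (\<lambda>x. frechet_derivative f (at x) v) S)"

definition smooth_on :: "'a::euclidean_space set \<Rightarrow> ('a \<Rightarrow> 'b::real_normed_vector) \<Rightarrow> bool" where
  "smooth_on S f \<longleftrightarrow> (\<forall>k. Ck_on k f S)"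

section \<open>Smooth manifolds\<close>

text \<open>The points of the manifold are the elements of the topological space \<open>'m\<close>, which is
  required to be Hausdorff and second countable by its sort; the model space is \<open>'e\<close>. A chart is
  a pair of its domain and its coordinate map; the values of the coordinate map outside the domain
  are irrelevant.\<close>

type_synonym ('m, 'e) chart = "'m set \<times> ('m \<Rightarrow> 'e)"

abbreviation dom_chart :: "('m, 'e) chart \<Rightarrow> 'm set" where
  "dom_chart \<phi> \<equiv> fst \<phi>"

abbreviation coord :: "('m, 'e) chart \<Rightarrow> 'm \<Rightarrow> 'e" where
  "coord \<phi> \<equiv> snd \<phi>"

definition inv_coord :: "('m, 'e) chart \<Rightarrow> 'e \<Rightarrow> 'm" where
  "inv_coord \<phi> = inv_into (dom_chart \<phi>) (coord \<phi>)"

definition transition :: "('m, 'e) chart \<Rightarrow> ('m, 'e) chart \<Rightarrow> 'e \<Rightarrow> 'e" where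
  "transition \<phi> \<psi> = coord \<psi> \<circ> inv_coord \<phi>"

definition is_chart :: "('m::topological_space, 'e::euclidean_space) chart \<Rightarrow> bool" where
  "is_chart \<phi> \<longleftrightarrow> open (dom_chart \<phi>) \<and> open (coord \<phi> ` dom_chart \<phi>) \<and>
     homeomorphism (dom_chart \<phi>) (coord \<phi> ` dom_chart \<phi>) (coord \<phi>) (inv_coord \<phi>)"

definition smooth_manifold ::
  "('m::{t2_space,second_countable_topology}, 'e::euclidean_space) chart set \<Rightarrow> bool" where
  "smooth_manifold A \<longleftrightarrow>
     connected (UNIV :: 'm set) \<and>
     (\<forall>\<phi>\<in>A. is_chart \<phi>) \<and> (\<Union>\<phi>\<in>A. dom_chart \<phi>) = UNIV \<and>
     (\<forall>\<phi>\<in>A. \<forall>\<psi>\<in>A. smooth_on (coord \<phi> ` (dom_chart \<phi> \<inter> dom_chart \<psi>)) (transition \<phi> \<psi>))"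

section \<open>Tangent vectors, fields and curves\<close>

text \<open>A tangent vector at \<open>p\<close> is the family of its components in the charts of the atlas around
  \<open>p\<close>, subject to the transformation law; components in other charts are set to \<open>0\<close>, so that
  the vector space operations are the componentwise ones.\<close>

type_synonym ('m, 'e) tvec = "('m, 'e) chart \<Rightarrow> 'e"

definition tangent_space ::
  "('m::topological_space, 'e::euclidean_space) chart set \<Rightarrow> 'm \<Rightarrow> ('m, 'e) tvec set" where
  "tangent_space A p = {v.
     (\<forall>\<phi>. \<not> (\<phi> \<in> A \<and> p \<in> dom_chart \<phi>) \<longrightarrow> v \<phi> = 0) \<and>
     (\<forall>\<phi>\<in>A. \<forall>\<psi>\<in>A. p \<in> dom_chart \<phi> \<inter> dom_chart \<psi> \<longrightarrow>
        v \<psi> = frechet_derivative (transition \<phi> \<psi>) (at (coord \<phi> p)) (v \<phi>))}"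

abbreviation zero_tvec :: "('m, 'e::euclidean_space) tvec" where
  "zero_tvec \<equiv> (\<lambda>\<phi>. 0)"

text \<open>The tangent vector at \<open>p\<close> whose component in the chart \<open>\<phi>\<close> is \<open>y\<close>.\<close>

definition tvec_of ::
  "('m::topological_space, 'e::euclidean_space) chart set \<Rightarrow> ('m, 'e) chart \<Rightarrow> 'm \<Rightarrow> 'e \<Rightarrow> ('m, 'e) tvec"
  where
  "tvec_of A \<phi> p y = (\<lambda>\<psi>. if \<psi> \<in> A \<and> p \<in> dom_chart \<psi>
     then frechet_derivative (transition \<phi> \<psi>) (at (coord \<phi> p)) y else 0)"

definition smooth_vector_field ::
  "('m::topological_space, 'e::euclidean_space) chart set \<Rightarrow> 'm set \<Rightarrow> ('m \<Rightarrow> ('m, 'e) tvec) \<Rightarrow> bool"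
  where
  "smooth_vector_field A U V \<longleftrightarrow> (\<forall>q\<in>U. V q \<in> tangent_space A q) \<and>
     (\<forall>\<phi>\<in>A. smooth_on (coord \<phi> ` (U \<inter> dom_chart \<phi>)) (\<lambda>x. V (inv_coord \<phi> x) \<phi>))"

text \<open>Below, \<open>J\<close> is an open interval wherever a curve is quantified over; a curve on a compact interval
  is the restriction of such a curve.\<close>

definition smooth_curve ::
  "('m::topological_space, 'e::euclidean_space) chart set \<Rightarrow> real set \<Rightarrow> (real \<Rightarrow> 'm) \<Rightarrow> bool" where
  "smooth_curve A J c \<longleftrightarrow> continuous_on J c \<and>
     (\<forall>\<phi>\<in>A. smooth_on {t\<in>J. c t \<in> dom_chart \<phi>} (coord \<phi> \<circ> c))"

definition velocity ::
  "('m::topological_space, 'e::euclidean_space) chart set \<Rightarrow> (real \<Rightarrow> 'm) \<Rightarrow> real \<Rightarrow> ('m, 'e) tvec" where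
  "velocity A c t = (\<lambda>\<phi>. if \<phi> \<in> A \<and> c t \<in> dom_chart \<phi>
     then vector_derivative (coord \<phi> \<circ> c) (at t) else 0)"

definition integral_curve ::
  "('m::topological_space, 'e::euclidean_space) chart set \<Rightarrow> ('m \<Rightarrow> ('m, 'e) tvec) \<Rightarrow> real set
    \<Rightarrow> (real \<Rightarrow> 'm) \<Rightarrow> bool" where
  "integral_curve A V J c \<longleftrightarrow> smooth_curve A J c \<and> (\<forall>t\<in>J. velocity A c t = V (c t))"

section \<open>Affine connections\<close>

text \<open>A connection is given by its Christoffel symbols: \<open>\<Gamma> \<phi> x u w\<close> is the vector with components
  \<open>\<Gamma>\<^sup>k\<^sub>i\<^sub>j u\<^sup>i w\<^sup>j\<close> in the chart \<open>\<phi>\<close> at the point with coordinates \<open>x\<close>, so that the covariant derivative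
  of a field with local representative \<open>W\<close> in direction \<open>u\<close> is \<open>DW(x)u + \<Gamma> \<phi> x u (W x)\<close>. The last but
  one condition is the transformation law that makes this expression a tangent vector; the
  last one fixes the irrelevant values.\<close>

type_synonym ('m, 'e) christoffel = "('m, 'e) chart \<Rightarrow> 'e \<Rightarrow> 'e \<Rightarrow> 'e \<Rightarrow> 'e"

definition affine_connection ::
  "('m::topological_space, 'e::euclidean_space) chart set \<Rightarrow> ('m, 'e) christoffel \<Rightarrow> bool" where
  "affine_connection A \<Gamma> \<longleftrightarrow>
     (\<forall>\<phi>\<in>A. \<forall>x\<in>coord \<phi> ` dom_chart \<phi>. bilinear (\<Gamma> \<phi> x)) \<and>
     (\<forall>\<phi>\<in>A. \<forall>u w. smooth_on (coord \<phi> ` dom_chart \<phi>) (\<lambda>x. \<Gamma> \<phi> x u w)) \<and>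
     (\<forall>\<phi>\<in>A. \<forall>\<psi>\<in>A. \<forall>x\<in>coord \<phi> ` (dom_chart \<phi> \<inter> dom_chart \<psi>). \<forall>u w.
        let \<tau> = transition \<phi> \<psi>; D = (\<lambda>z. frechet_derivative \<tau> (at z)) in
        D x (\<Gamma> \<phi> x u w) =
          frechet_derivative (\<lambda>z. D z w) (at x) u + \<Gamma> \<psi> (\<tau> x) (D x u) (D x w)) \<and>
     (\<forall>\<phi> x u w. \<not> (\<phi> \<in> A \<and> x \<in> coord \<phi> ` dom_chart \<phi>) \<longrightarrow> \<Gamma> \<phi> x u w = 0)"

definition torsion_free ::
  "('m::topological_space, 'e::euclidean_space) chart set \<Rightarrow> ('m, 'e) christoffel \<Rightarrow> bool" where
  "torsion_free A \<Gamma> \<longleftrightarrow>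
     (\<forall>\<phi>\<in>A. \<forall>x\<in>coord \<phi> ` dom_chart \<phi>. \<forall>u w. \<Gamma> \<phi> x u w = \<Gamma> \<phi> x w u)"

definition parallel_along ::
  "('m::topological_space, 'e::euclidean_space) chart set \<Rightarrow> ('m, 'e) christoffel \<Rightarrow> real set
    \<Rightarrow> (real \<Rightarrow> 'm) \<Rightarrow> (real \<Rightarrow> ('m, 'e) tvec) \<Rightarrow> bool" where
  "parallel_along A \<Gamma> J c X \<longleftrightarrow>
     (\<forall>t\<in>J. X t \<in> tangent_space A (c t)) \<and>
     (\<forall>\<phi>\<in>A. \<forall>t\<in>J. c t \<in> dom_chart \<phi> \<longrightarrow>
        ((\<lambda>s. X s \<phi>) has_vector_derivative
           - \<Gamma> \<phi> (coord \<phi> (c t)) (velocity A c t \<phi>) (X t \<phi>)) (at t))"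

definition geodesic ::
  "('m::topological_space, 'e::euclidean_space) chart set \<Rightarrow> ('m, 'e) christoffel \<Rightarrow> real set
    \<Rightarrow> (real \<Rightarrow> 'm) \<Rightarrow> bool" where
  "geodesic A \<Gamma> J c \<longleftrightarrow> smooth_curve A J c \<and> parallel_along A \<Gamma> J c (velocity A c)"

text \<open>Curvature \<open>R(u,v)w = \<nabla>\<^sub>u\<nabla>\<^sub>v w - \<nabla>\<^sub>v\<nabla>\<^sub>u w\<close> for constant coordinate fields \<open>u\<close>, \<open>v\<close>, \<open>w\<close>; the Ricci
  tensor is the trace of \<open>u \<mapsto> R(u,v)w\<close>. It does not depend on the chart.\<close>

definition curvature ::
  "('m, 'e::euclidean_space) christoffel \<Rightarrow> ('m, 'e) chart \<Rightarrow> 'e \<Rightarrow> 'e \<Rightarrow> 'e \<Rightarrow> 'e \<Rightarrow> 'e" where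
  "curvature \<Gamma> \<phi> x u v w =
     frechet_derivative (\<lambda>z. \<Gamma> \<phi> z v w) (at x) u - frechet_derivative (\<lambda>z. \<Gamma> \<phi> z u w) (at x) v
     + \<Gamma> \<phi> x u (\<Gamma> \<phi> x v w) - \<Gamma> \<phi> x v (\<Gamma> \<phi> x u w)"

definition ricci_tensor ::
  "('m::topological_space, 'e::euclidean_space) chart set \<Rightarrow> ('m, 'e) christoffel \<Rightarrow> 'm
    \<Rightarrow> ('m, 'e) tvec \<Rightarrow> ('m, 'e) tvec \<Rightarrow> real" where
  "ricci_tensor A \<Gamma> p v w = (THE r. \<exists>\<phi>\<in>A. p \<in> dom_chart \<phi> \<and>
     r = (\<Sum>b\<in>Basis. curvature \<Gamma> \<phi> (coord \<phi> p) b (v \<phi>) (w \<phi>) \<bullet> b))"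

section \<open>Riemannian metrics\<close>

type_synonym ('m, 'e) riem_metric = "'m \<Rightarrow> ('m, 'e) tvec \<Rightarrow> ('m, 'e) tvec \<Rightarrow> real"

definition metric_in_chart ::
  "('m::topological_space, 'e::euclidean_space) chart set \<Rightarrow> ('m, 'e) riem_metric \<Rightarrow> ('m, 'e) chart
    \<Rightarrow> 'e \<Rightarrow> 'e \<Rightarrow> 'e \<Rightarrow> real" where
  "metric_in_chart A g \<phi> x u w =
     (let q = inv_coord \<phi> x in g q (tvec_of A \<phi> q u) (tvec_of A \<phi> q w))"

text \<open>The Christoffel symbols
  \<open>\<Gamma>\<^sup>k\<^sub>i\<^sub>j = 1/2 g\<^sup>k\<^sup>l (\<partial>\<^sub>i g\<^sub>j\<^sub>l + \<partial>\<^sub>j g\<^sub>i\<^sub>l - \<partial>\<^sub>l g\<^sub>i\<^sub>j)\<close> of the Levi-Civita connection, with the index \<open>k\<close> lowered.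
  A metric on an open subset \<open>U\<close> gives meaningful values over \<open>U\<close>.\<close>

definition levi_civita ::
  "('m::topological_space, 'e::euclidean_space) chart set \<Rightarrow> ('m, 'e) riem_metric \<Rightarrow> ('m, 'e) christoffel"
  where
  "levi_civita A g = (\<lambda>\<phi> x u w. let G = metric_in_chart A g \<phi> in
     (THE z. \<forall>y. 2 * G x z y =
        frechet_derivative (\<lambda>x. G x w y) (at x) u + frechet_derivative (\<lambda>x. G x u y) (at x) w
        - frechet_derivative (\<lambda>x. G x u w) (at x) y))"

section \<open>Finsler structures and Berwald spaces\<close>

type_synonym ('m, 'e) finsler_fun = "'m \<Rightarrow> ('m, 'e) tvec \<Rightarrow> real"

text \<open>The Hessian of \<open>F\<^sup>2/2\<close> restricted to the tangent space at \<open>p\<close>, taken at \<open>v\<close>.\<close>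

definition fundamental_tensor ::
  "('m, 'e::euclidean_space) finsler_fun \<Rightarrow> 'm \<Rightarrow> ('m, 'e) tvec \<Rightarrow> ('m, 'e) tvec \<Rightarrow> ('m, 'e) tvec \<Rightarrow> real"
  where
  "fundamental_tensor F p v u w =
     deriv (\<lambda>s. deriv (\<lambda>t. (F p (\<lambda>\<phi>. v \<phi> + s *\<^sub>R u \<phi> + t *\<^sub>R w \<phi>))\<^sup>2 / 2) 0) (0::real)"

text \<open>Bilinearity and symmetry of the Hessian are automatic for smooth \<open>F\<close>.\<close>

definition finsler_structure ::
  "('m::topological_space, 'e::euclidean_space) chart set \<Rightarrow> ('m, 'e) finsler_fun \<Rightarrow> bool" where
  "finsler_structure A F \<longleftrightarrow>
     (\<forall>p. \<forall>v\<in>tangent_space A p. 0 \<le> F p v) \<and>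
     (\<forall>\<phi>\<in>A. smooth_on ((coord \<phi> ` dom_chart \<phi>) \<times> (UNIV - {0}))
        (\<lambda>(x, y). F (inv_coord \<phi> x) (tvec_of A \<phi> (inv_coord \<phi> x) y))) \<and>
     (\<forall>p. \<forall>v\<in>tangent_space A p. \<forall>l>0. F p (\<lambda>\<phi>. l *\<^sub>R v \<phi>) = l * F p v) \<and>
     (\<forall>p. \<forall>v\<in>tangent_space A p - {zero_tvec}. \<forall>u\<in>tangent_space A p - {zero_tvec}.
        0 < fundamental_tensor F p v u u)"

text \<open>Parallel transport along \<open>c\<close> from \<open>c s\<close> to \<open>c t\<close> maps \<open>X s\<close> to \<open>X t\<close> for parallel \<open>X\<close>.\<close>

definition parallel_transport_preserves ::
  "('m::topological_space, 'e::euclidean_space) chart set \<Rightarrow> ('m, 'e) christoffel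
    \<Rightarrow> ('m, 'e) finsler_fun \<Rightarrow> bool" where
  "parallel_transport_preserves A \<Gamma> F \<longleftrightarrow>
     (\<forall>J c X. open J \<and> is_interval J \<and> smooth_curve A J c \<and> parallel_along A \<Gamma> J c X \<longrightarrow>
        (\<forall>s\<in>J. \<forall>t\<in>J. F (c s) (X s) = F (c t) (X t)))"

definition is_induced_connection ::
  "('m::topological_space, 'e::euclidean_space) chart set \<Rightarrow> ('m, 'e) finsler_fun
    \<Rightarrow> ('m, 'e) christoffel \<Rightarrow> bool" where
  "is_induced_connection A F \<Gamma> \<longleftrightarrow>
     affine_connection A \<Gamma> \<and> torsion_free A \<Gamma> \<and> parallel_transport_preserves A \<Gamma> F"

definition berwald_space ::
  "('m::{t2_space,second_countable_topology}, 'e::euclidean_space) chart set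
    \<Rightarrow> ('m, 'e) finsler_fun \<Rightarrow> bool" where
  "berwald_space A F \<longleftrightarrow>
     smooth_manifold A \<and> finsler_structure A F \<and> (\<exists>\<Gamma>. is_induced_connection A F \<Gamma>)"

text \<open>A connection that is torsion-free and whose parallel transport preserves \<open>F\<close> is unique, as its
  values outside the coordinate domains are fixed.\<close>

definition induced_connection ::
  "('m::topological_space, 'e::euclidean_space) chart set \<Rightarrow> ('m, 'e) finsler_fun
    \<Rightarrow> ('m, 'e) christoffel" where
  "induced_connection A F = (THE \<Gamma>. is_induced_connection A F \<Gamma>)"

definition affinely_equivalent ::
  "('m::topological_space, 'e::euclidean_space) chart set \<Rightarrow> ('m, 'e) finsler_fun
    \<Rightarrow> ('m, 'e) finsler_fun \<Rightarrow> bool" where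
  "affinely_equivalent A F F' \<longleftrightarrow> induced_connection A F = induced_connection A F'"

section \<open>Ricci curvature\<close>

definition geodesic_extension ::
  "('m::topological_space, 'e::euclidean_space) chart set \<Rightarrow> ('m, 'e) finsler_fun \<Rightarrow> 'm
    \<Rightarrow> ('m, 'e) tvec \<Rightarrow> 'm set \<Rightarrow> ('m \<Rightarrow> ('m, 'e) tvec) \<Rightarrow> bool" where
  "geodesic_extension A F p v U V \<longleftrightarrow>
     open U \<and> p \<in> U \<and> smooth_vector_field A U V \<and> (\<forall>q\<in>U. V q \<noteq> zero_tvec) \<and> V p = v \<and>
     (\<forall>J c. open J \<and> is_interval J \<and> c ` J \<subseteq> U \<and> integral_curve A V J c \<longrightarrow>
        geodesic A (induced_connection A F) J c)"

text \<open>The description below relies on the independence of the choice of \<open>V\<close>.\<close>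

definition ricci_curvature ::
  "('m::topological_space, 'e::euclidean_space) chart set \<Rightarrow> ('m, 'e) finsler_fun \<Rightarrow> 'm
    \<Rightarrow> ('m, 'e) tvec \<Rightarrow> real" where
  "ricci_curvature A F p v =
     (if v = zero_tvec then 0
      else THE r. \<exists>U V. geodesic_extension A F p v U V \<and>
        r = ricci_tensor A (levi_civita A (\<lambda>q. fundamental_tensor F q (V q))) p v v)"

definition nonneg_ricci ::
  "('m::topological_space, 'e::euclidean_space) chart set \<Rightarrow> ('m, 'e) finsler_fun \<Rightarrow> bool" where
  "nonneg_ricci A F \<longleftrightarrow> (\<forall>p. \<forall>v\<in>tangent_space A p. 0 \<le> ricci_curvature A F p v)"

definition nonpos_ricci ::
  "('m::topological_space, 'e::euclidean_space) chart set \<Rightarrow> ('m, 'e) finsler_fun \<Rightarrow> bool" where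
  "nonpos_ricci A F \<longleftrightarrow> (\<forall>p. \<forall>v\<in>tangent_space A p. ricci_curvature A F p v \<le> 0)"

end

theory Submission
  imports Defs
begin

text \<open>Let \<open>\<nabla>\<close> be the induced connection, \<open>V\<close> a geodesic field, \<open>g\<close> the metric \<open>g\<^sub>V\<close> and \<open>C\<close> its
  Levi-Civita connection. Since \<open>\<nabla>\<close> preserves \<open>F\<close>, the derivative \<open>(\<nabla>\<^sub>u g)(a, b)\<close> is
  \<open>T(\<nabla>\<^sub>u V, a, b)\<close>, where \<open>T\<close> is the third vertical derivative of \<open>F\<^sup>2/2\<close> at \<open>V\<close>. It is
  symmetric, and by homogeneity it vanishes if one of its arguments is \<open>V\<close>; moreover \<open>\<nabla>\<^sub>V V = 0\<close>. Hence the Koszul formula shows that the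
  difference \<open>D = C - \<nabla>\<close> satisfies \<open>D(u, V) = 0\<close>, and so \<open>R(u, V)V\<close> is the same for \<open>C\<close> and \<open>\<nabla>\<close>. Therefore
  \<open>Ric\<^sub>F\<close> is determined by the Ricci tensor of \<open>\<nabla>\<close> and by the geodesic fields, both of which depend only
  on \<open>\<nabla>\<close>.

  That \<open>\<nabla>\<close> preserves \<open>F\<close> and that \<open>V\<close> is geodesic is only known along parallel fields and integral
  curves, so the pointwise identities require the local existence of these.\<close>

section \<open>Calculus of smooth maps\<close>

text \<open>Only R(u, V)V enters the Ricci tensor at (v, v); hence D(u, V) = 0 is enough although D
  itself may be nonzero. The vanishing of T on V is Euler's relation: the fundamental tensor is
  homogeneous of degree 0 in the fibre variable, so it is constant along rays.

  Curvature differentiates Christoffel symbols, whereas \<open>levi_civita\<close> gives them only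
  as a pointwise definite description, with no regularity attached. Instead of inverting the Gram
  matrix smoothly, the proof derives continuity of the symbols from the stability of linear systems.
  The derivatives that occur are those of D(u, v) with v = V(x) held fixed, and they exist because
  D(u, V) vanishes on a whole neighbourhood of x.

  All differentiation takes place in one chart, where F^2/2 is a function of pairs (x, y) with y
  nonzero. The induced connection is again a definite description and is made meaningful by a
  uniqueness proof; the descriptions in the two Ricci notions are compared by showing that their
  defining predicates coincide.\<close>

lemma linear_basis_expansion:
  fixes f :: "'a::euclidean_space \<Rightarrow> 'b::real_vector"
  assumes "linear f"
  shows "f v = (\<Sum>b\<in>Basis. (v \<bullet> b) *\<^sub>R f b)"
  using linear_sum[OF assms, of "\<lambda>b. (v \<bullet> b) *\<^sub>R b" Basis]
  by (simp add: euclidean_representation linear_scale[OF assms])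

section \<open>Closure properties of the classes \<open>Ck_on\<close> and
  \<open>smooth_on\<close>\<close>

lemma Ck_on_subset: "Ck_on k f S \<Longrightarrow> T \<subseteq> S \<Longrightarrow> Ck_on k f T"
  by (induction k arbitrary: f) (auto intro: continuous_on_subset)

lemma Ck_on_cong:
  assumes "open S" "\<And>x. x \<in> S \<Longrightarrow> f x = g x" "Ck_on k f S"
  shows "Ck_on k g S"
  using assms(2,3)
proof (induction k arbitrary: f g)
  case 0
  then show ?case by (simp cong: continuous_on_cong)
next
  case (Suc k)
  have eq: "frechet_derivative f (at x) = frechet_derivative g (at x)" if "x \<in> S" for x
    using that Suc.prems \<open>open S\<close> by (intro frechet_derivative_transform_within_open[where X=S]) auto
  have "g differentiable (at x)" if "x \<in> S" for x
  proof -
    have "(f has_derivative frechet_derivative f (at x)) (at x)"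
      using that Suc.prems(2) by (simp flip: frechet_derivative_works)
    then have "(g has_derivative frechet_derivative f (at x)) (at x)"
      by (rule has_derivative_transform_within_open[OF _ \<open>open S\<close> that]) (rule Suc.prems(1))
    then show ?thesis by (rule differentiableI)
  qed
  moreover have "Ck_on k (\<lambda>x. frechet_derivative g (at x) v) S" for v
    by (rule Suc.IH[where f = "\<lambda>x. frechet_derivative f (at x) v"]) (use Suc.prems eq in auto)
  ultimately show ?case by simp
qed

text \<open>The defining clause speaks of \<open>frechet_derivative\<close>; here any formula for
  the derivative may be supplied. The closure proofs below get their induction step from
  this.\<close>

lemma Ck_on_SucI:
  assumes "open S" "\<And>x. x \<in> S \<Longrightarrow> (f has_derivative f' x) (at x)"
    "\<And>v. Ck_on k (\<lambda>x. f' x v) S"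
  shows "Ck_on (Suc k) f S"
proof -
  have "Ck_on k (\<lambda>x. frechet_derivative f (at x) v) S" for v
    by (rule Ck_on_cong[OF assms(1) _ assms(3)[of v]]) (metis assms(2) frechet_derivative_at)
  then show ?thesis using assms(2) by (auto intro: differentiableI)
qed

lemma Ck_on_SucD:
  assumes "Ck_on (Suc k) f S" "x \<in> S"
  shows "(f has_derivative frechet_derivative f (at x)) (at x)"
  using assms by (simp flip: frechet_derivative_works)

lemma Ck_on_Suc_imp: "Ck_on (Suc k) f S \<Longrightarrow> Ck_on k f S"
proof (induction k arbitrary: f)
  case 0
  then show ?case
    by (simp add: continuous_at_imp_continuous_on differentiable_imp_continuous_within)
next
  case (Suc k)
  have "Ck_on k (\<lambda>x. frechet_derivative f (at x) v) S" for v
    using Suc.prems by (intro Suc.IH) simp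
  then show ?case using Suc.prems by simp
qed

lemma Ck_on_const: "Ck_on k (\<lambda>x. c) S"
  by (induction k arbitrary: c) auto

lemma Ck_on_bounded_linear:
  assumes "bounded_linear h" "open S"
  shows "Ck_on k f S \<Longrightarrow> Ck_on k (\<lambda>x. h (f x)) S"
proof (induction k arbitrary: f)
  case 0
  then show ?case using assms by (simp add: bounded_linear.continuous_on)
next
  case (Suc k)
  show ?case
  proof (rule Ck_on_SucI[OF \<open>open S\<close>])
    show "((\<lambda>x. h (f x)) has_derivative (\<lambda>v. h (frechet_derivative f (at x) v))) (at x)"
      if "x \<in> S" for x
      by (rule bounded_linear.has_derivative[OF assms(1)]) (rule Ck_on_SucD[OF Suc.prems that])
    show "Ck_on k (\<lambda>x. h (frechet_derivative f (at x) v)) S" for v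
      using Suc by simp
  qed
qed

lemma Ck_on_add:
  assumes "open S"
  shows "Ck_on k f S \<Longrightarrow> Ck_on k g S \<Longrightarrow> Ck_on k (\<lambda>x. f x + g x) S"
proof (induction k arbitrary: f g)
  case 0
  then show ?case by (simp add: continuous_on_add)
next
  case (Suc k)
  show ?case
  proof (rule Ck_on_SucI[OF \<open>open S\<close>])
    show "((\<lambda>x. f x + g x) has_derivative
        (\<lambda>v. frechet_derivative f (at x) v + frechet_derivative g (at x) v)) (at x)"
      if "x \<in> S" for x
      by (rule has_derivative_add; rule Ck_on_SucD[OF _ that]; fact)
    show "Ck_on k (\<lambda>x. frechet_derivative f (at x) v + frechet_derivative g (at x) v) S" for v
      using Suc by simp
  qed
qed

lemma Ck_on_bilinear:
  assumes "bounded_bilinear p" "open S"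
  shows "Ck_on k f S \<Longrightarrow> Ck_on k g S \<Longrightarrow> Ck_on k (\<lambda>x. p (f x) (g x)) S"
proof (induction k arbitrary: f g)
  case 0
  then show ?case using assms by (simp add: bounded_bilinear.continuous_on)
next
  case (Suc k)
  show ?case
  proof (rule Ck_on_SucI[OF \<open>open S\<close>])
    show "((\<lambda>x. p (f x) (g x)) has_derivative
        (\<lambda>v. p (f x) (frechet_derivative g (at x) v) + p (frechet_derivative f (at x) v) (g x))) (at x)"
      if "x \<in> S" for x
      by (rule bounded_bilinear.FDERIV[OF assms(1)]; rule Ck_on_SucD[OF _ that]; fact)
    show "Ck_on k (\<lambda>x. p (f x) (frechet_derivative g (at x) v)
        + p (frechet_derivative f (at x) v) (g x)) S" for v
      by (intro Ck_on_add[OF \<open>open S\<close>] Suc.IH Ck_on_Suc_imp[OF Suc.prems(1)]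
          Ck_on_Suc_imp[OF Suc.prems(2)]) (use Suc.prems in auto)
  qed
qed

lemma Ck_on_sum:
  assumes "open S" "\<And>i. i \<in> I \<Longrightarrow> Ck_on k (f i) S"
  shows "Ck_on k (\<lambda>x. \<Sum>i\<in>I. f i x) S"
proof (cases "finite I")
  case True
  then show ?thesis using assms(2)
    by induction (simp_all add: Ck_on_const Ck_on_add[OF assms(1)] del: Ck_on.simps)
qed (simp add: Ck_on_const)

lemma Ck_on_Pair:
  assumes "open S" "Ck_on k f S" "Ck_on k g S"
  shows "Ck_on k (\<lambda>x. (f x, g x)) S"
proof -
  have "Ck_on k (\<lambda>x. (f x, 0) + (0, g x)) S"
    by (intro Ck_on_add assms Ck_on_bounded_linear[where h="\<lambda>a. (a, 0)"]
        Ck_on_bounded_linear[where h="\<lambda>a. (0, a)"] bounded_linear_Pair bounded_linear_ident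
        bounded_linear_zero)
  then show ?thesis by simp
qed

lemma Ck_on_comp:
  fixes f :: "'b::euclidean_space \<Rightarrow> 'c::real_normed_vector"
    and g :: "'a::euclidean_space \<Rightarrow> 'b"
  assumes "open S" "open T" "\<And>x. x \<in> S \<Longrightarrow> g x \<in> T"
  shows "Ck_on k f T \<Longrightarrow> Ck_on k g S \<Longrightarrow> Ck_on k (\<lambda>x. f (g x)) S"
proof (induction k arbitrary: f)
  case 0
  then show ?case using assms(3)
    by (auto intro: continuous_on_compose2)
next
  case (Suc k)
  show ?case
  proof (rule Ck_on_SucI[OF \<open>open S\<close>])
    fix x assume x: "x \<in> S"
    let ?f' = "frechet_derivative f (at (g x))" and ?g' = "frechet_derivative g (at x)"
    have f': "(f has_derivative ?f') (at (g x))" and g': "(g has_derivative ?g') (at x)"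
      using Suc.prems x assms(3) by (blast intro: Ck_on_SucD)+
    \<comment> \<open>\<open>Ck_on\<close> controls derivatives in fixed directions only, but the
      direction \<open>?g' v\<close> moves with \<open>x\<close>. Expanding it in the basis leaves
      products of functions known to be \<open>Ck\<close>.\<close>
    have "?f' (?g' v) = (\<Sum>b\<in>Basis. (?g' v \<bullet> b) *\<^sub>R ?f' b)" for v
      by (rule linear_basis_expansion[OF has_derivative_linear[OF f']])
    then show "((\<lambda>x. f (g x)) has_derivative
        (\<lambda>v. \<Sum>b\<in>Basis. (?g' v \<bullet> b) *\<^sub>R ?f' b)) (at x)"
      using has_derivative_compose[OF g' f'] by simp
  next
    fix v
    have "Ck_on k (\<lambda>x. frechet_derivative f (at (g x)) b) S" for b
      by (rule Suc.IH[OF _ Ck_on_Suc_imp[OF Suc.prems(2)]]) (use Suc.prems in auto)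
    moreover have "Ck_on k (\<lambda>x. frechet_derivative g (at x) v \<bullet> b) S" for b
      using Suc.prems by (intro Ck_on_bounded_linear[OF bounded_linear_inner_left assms(1)]) auto
    ultimately show "Ck_on k (\<lambda>x. \<Sum>b\<in>Basis.
        (frechet_derivative g (at x) v \<bullet> b) *\<^sub>R frechet_derivative f (at (g x)) b) S"
      by (intro Ck_on_sum[OF assms(1)] Ck_on_bilinear[OF bounded_bilinear_scaleR assms(1)])
  qed
qed

lemma smooth_on_subset: "smooth_on S f \<Longrightarrow> T \<subseteq> S \<Longrightarrow> smooth_on T f"
  unfolding smooth_on_def by (blast intro: Ck_on_subset[of _ f S T])

lemma smooth_on_cong: "open S \<Longrightarrow> (\<And>x. x \<in> S \<Longrightarrow> f x = g x) \<Longrightarrow> smooth_on S f \<Longrightarrow> smooth_on S g"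
  unfolding smooth_on_def by (metis Ck_on_cong[of S f g])

lemma smooth_on_const: "smooth_on S (\<lambda>x. c)"
  by (simp add: smooth_on_def Ck_on_const)

lemma smooth_on_bounded_linear:
  "bounded_linear h \<Longrightarrow> open S \<Longrightarrow> smooth_on S f \<Longrightarrow> smooth_on S (\<lambda>x. h (f x))"
  by (simp add: smooth_on_def Ck_on_bounded_linear)

lemma smooth_on_sum:
  "open S \<Longrightarrow> (\<And>i. i \<in> I \<Longrightarrow> smooth_on S (f i)) \<Longrightarrow> smooth_on S (\<lambda>x. \<Sum>i\<in>I. f i x)"
  by (simp add: smooth_on_def Ck_on_sum)

lemma smooth_on_scaleR:
  fixes f :: "'a::euclidean_space \<Rightarrow> real"
  shows "open S \<Longrightarrow> smooth_on S f \<Longrightarrow> smooth_on S g \<Longrightarrow> smooth_on S (\<lambda>x. f x *\<^sub>R g x)"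
  by (simp add: smooth_on_def Ck_on_bilinear[OF bounded_bilinear_scaleR])

lemma smooth_on_Pair:
  "open S \<Longrightarrow> smooth_on S f \<Longrightarrow> smooth_on S g \<Longrightarrow> smooth_on S (\<lambda>x. (f x, g x))"
  by (simp add: smooth_on_def Ck_on_Pair)

lemma smooth_on_comp:
  fixes g :: "'a::euclidean_space \<Rightarrow> 'b::euclidean_space"
  assumes "open S" "open T" "\<And>x. x \<in> S \<Longrightarrow> g x \<in> T" "smooth_on T f" "smooth_on S g"
  shows "smooth_on S (\<lambda>x. f (g x))"
  using assms by (simp add: smooth_on_def Ck_on_comp[of S T])

lemma smooth_on_ident: "open S \<Longrightarrow> smooth_on S (\<lambda>x. x)"
  unfolding smooth_on_def
proof
  fix k assume "open S"
  then show "Ck_on k (\<lambda>x. x) S"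
    by (cases k) (simp_all only: Ck_on_SucI[OF _ has_derivative_ident Ck_on_const] Ck_on.simps(1) continuous_on_id)
qed

lemma smooth_on_linear: "open S \<Longrightarrow> bounded_linear h \<Longrightarrow> smooth_on S h"
  using smooth_on_bounded_linear[OF _ _ smooth_on_ident] by blast

lemma smooth_on_has_derivative:
  "smooth_on S f \<Longrightarrow> x \<in> S \<Longrightarrow> (f has_derivative frechet_derivative f (at x)) (at x)"
  by (rule Ck_on_SucD[of 0]) (simp_all only: smooth_on_def)

lemma smooth_on_frechet: "smooth_on S f \<Longrightarrow> smooth_on S (\<lambda>x. frechet_derivative f (at x) v)"
  unfolding smooth_on_def
proof
  fix k assume "\<forall>k. Ck_on k f S"
  then have "Ck_on (Suc k) f S" ..
  then show "Ck_on k (\<lambda>x. frechet_derivative f (at x) v) S" by simp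
qed

lemma smooth_on_continuous: "smooth_on S f \<Longrightarrow> continuous_on S f"
  unfolding smooth_on_def by (metis Ck_on.simps(1))

section \<open>Symmetry of second derivatives\<close>

lemma has_derivative_along_line:
  assumes "(f has_derivative f') (at (p + s *\<^sub>R u))"
  shows "((\<lambda>t. f (p + t *\<^sub>R u)) has_vector_derivative f' u) (at s)"
proof -
  have "((\<lambda>t. p + t *\<^sub>R u) has_derivative (\<lambda>t. t *\<^sub>R u)) (at s)"
    by (auto intro!: derivative_eq_intros)
  from has_derivative_compose[OF this assms] show ?thesis
    by (simp add: has_vector_derivative_def linear_scale[OF has_derivative_linear[OF assms]])
qed

text \<open>The mean value theorem is applied twice: in direction \<open>u\<close> to the difference
  of \<open>f\<close> on two opposite sides of the parallelogram, then in direction \<open>v\<close>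
  to the derivative obtained.\<close>

lemma second_difference:
  fixes f :: "'a::euclidean_space \<Rightarrow> real"
  assumes "smooth_on S f" "0 < h"
    and S: "\<And>s t. 0 \<le> s \<Longrightarrow> s \<le> h \<Longrightarrow> 0 \<le> t \<Longrightarrow> t \<le> h \<Longrightarrow> x + s *\<^sub>R u + t *\<^sub>R v \<in> S"
  obtains s t where "0 < s" "s < h" "0 < t" "t < h"
    "f (x + h *\<^sub>R u + h *\<^sub>R v) - f (x + h *\<^sub>R u) - (f (x + h *\<^sub>R v) - f x)
      = h * (h * frechet_derivative (\<lambda>z. frechet_derivative f (at z) u) (at (x + s *\<^sub>R u + t *\<^sub>R v)) v)"
proof -
  let ?g = "\<lambda>z. frechet_derivative f (at z) u"
  have "((\<lambda>s. f ((x + h *\<^sub>R v) + s *\<^sub>R u) - f (x + s *\<^sub>R u)) has_vector_derivative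
      (?g ((x + h *\<^sub>R v) + s *\<^sub>R u) - ?g (x + s *\<^sub>R u))) (at s)" if "0 \<le> s" "s \<le> h" for s
    using S[of s h] S[of s 0] that assms(2)
    by (intro has_vector_derivative_diff has_derivative_along_line
        smooth_on_has_derivative[OF assms(1)]) (simp_all add: ac_simps)
  then have "\<And>s. 0 \<le> s \<Longrightarrow> s \<le> h \<Longrightarrow>
      ((\<lambda>s. f ((x + h *\<^sub>R v) + s *\<^sub>R u) - f (x + s *\<^sub>R u)) has_real_derivative
        (?g ((x + h *\<^sub>R v) + s *\<^sub>R u) - ?g (x + s *\<^sub>R u))) (at s)"
    by (simp add: has_real_derivative_iff_has_vector_derivative)
  from MVT2[OF assms(2) this] obtain s where s: "0 < s" "s < h"
    and 1: "f ((x + h *\<^sub>R v) + h *\<^sub>R u) - f (x + h *\<^sub>R u) - (f (x + h *\<^sub>R v) - f x)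
      = h * (?g ((x + h *\<^sub>R v) + s *\<^sub>R u) - ?g (x + s *\<^sub>R u))" by auto
  have "((\<lambda>t. ?g ((x + s *\<^sub>R u) + t *\<^sub>R v)) has_vector_derivative
      frechet_derivative ?g (at ((x + s *\<^sub>R u) + t *\<^sub>R v)) v) (at t)" if "0 \<le> t" "t \<le> h" for t
    using S[of s t] that s
    by (intro has_derivative_along_line smooth_on_has_derivative[OF smooth_on_frechet[OF assms(1)]]) auto
  then have "\<And>t. 0 \<le> t \<Longrightarrow> t \<le> h \<Longrightarrow>
      ((\<lambda>t. ?g ((x + s *\<^sub>R u) + t *\<^sub>R v)) has_real_derivative
        frechet_derivative ?g (at ((x + s *\<^sub>R u) + t *\<^sub>R v)) v) (at t)"
    by (simp add: has_real_derivative_iff_has_vector_derivative)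
  from MVT2[OF assms(2) this] obtain t where t: "0 < t" "t < h"
    and 2: "?g ((x + s *\<^sub>R u) + h *\<^sub>R v) - ?g (x + s *\<^sub>R u)
      = h * frechet_derivative ?g (at ((x + s *\<^sub>R u) + t *\<^sub>R v)) v" by auto
  have "f (x + h *\<^sub>R u + h *\<^sub>R v) - f (x + h *\<^sub>R u) - (f (x + h *\<^sub>R v) - f x)
      = h * (h * frechet_derivative ?g (at (x + s *\<^sub>R u + t *\<^sub>R v)) v)"
    using 1 2 by (simp add: ac_simps)
  with s t show thesis using that by blast
qed

text \<open>The second difference is symmetric in \<open>u\<close> and \<open>v\<close>, so the two
  mixed derivatives take a common value at two points of a small parallelogram at \<open>x\<close>.
  Continuity of both at \<open>x\<close> then bounds their difference there by any
  \<open>e\<close>.\<close>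

theorem frechet_derivative_commute:
  fixes f :: "'a::euclidean_space \<Rightarrow> real"
  assumes "open S" "smooth_on S f" "x \<in> S"
  shows "frechet_derivative (\<lambda>z. frechet_derivative f (at z) u) (at x) v
       = frechet_derivative (\<lambda>z. frechet_derivative f (at z) v) (at x) u"
proof -
  define a where "a = (\<lambda>z. frechet_derivative (\<lambda>z. frechet_derivative f (at z) u) (at z) v)"
  define b where "b = (\<lambda>z. frechet_derivative (\<lambda>z. frechet_derivative f (at z) v) (at z) u)"
  have cont: "continuous_on S a" "continuous_on S b"
    unfolding a_def b_def by (intro smooth_on_continuous smooth_on_frechet assms(2))+
  have "\<bar>a x - b x\<bar> \<le> e" if "0 < e" for e
  proof -
    have "0 < e/2" using that by simp
    obtain d1 where d1: "0 < d1" "ball x d1 \<subseteq> S" using assms by (meson open_contains_ball)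
    obtain d2 where d2: "0 < d2" "\<And>z. z \<in> S \<Longrightarrow> dist z x < d2 \<Longrightarrow> dist (a z) (a x) < e/2"
      using cont(1) assms(3) \<open>0 < e/2\<close> by (meson continuous_on_iff)
    obtain d3 where d3: "0 < d3" "\<And>z. z \<in> S \<Longrightarrow> dist z x < d3 \<Longrightarrow> dist (b z) (b x) < e/2"
      using cont(2) assms(3) \<open>0 < e/2\<close> by (meson continuous_on_iff)
    define d where "d = min d1 (min d2 d3)"
    \<comment> \<open>With this side length the whole parallelogram lies within distance
      \<open>d\<close> of \<open>x\<close>; the summand 1 keeps the denominator positive when
      \<open>u\<close> and \<open>v\<close> are 0.\<close>
    define h where "h = d / (norm u + norm v + 1)"
    have n: "0 < norm u + norm v + 1" using norm_ge_zero[of u] norm_ge_zero[of v] by linarith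
    have "0 < d" using d1 d2 d3 by (simp add: d_def)
    then have h: "0 < h" using n by (simp add: h_def)
    have near: "dist (x + s *\<^sub>R u + t *\<^sub>R v) x < d"
      if "0 \<le> s" "s \<le> h" "0 \<le> t" "t \<le> h" for s t
    proof -
      have "dist (x + s *\<^sub>R u + t *\<^sub>R v) x \<le> s * norm u + t * norm v"
        using norm_triangle_ineq[of "s *\<^sub>R u" "t *\<^sub>R v"] that by (simp add: dist_norm)
      also have "\<dots> \<le> h * norm u + h * norm v"
        using that by (intro add_mono mult_right_mono) auto
      also have "\<dots> < h * (norm u + norm v + 1)" using h by (simp add: algebra_simps)
      also have "\<dots> = d" using n by (simp add: h_def)
      finally show ?thesis .
    qed
    have inS: "x + s *\<^sub>R u + t *\<^sub>R v \<in> S" if "0 \<le> s" "s \<le> h" "0 \<le> t" "t \<le> h" for s t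
      using near[OF that] d1 by (auto simp: d_def dist_commute subset_iff)
    obtain s t where st: "0 < s" "s < h" "0 < t" "t < h"
      "f (x + h *\<^sub>R u + h *\<^sub>R v) - f (x + h *\<^sub>R u) - (f (x + h *\<^sub>R v) - f x)
      = h * (h * a (x + s *\<^sub>R u + t *\<^sub>R v))"
      unfolding a_def by (rule second_difference[OF assms(2) h inS])
    have inS': "x + s *\<^sub>R v + t *\<^sub>R u \<in> S" if "0 \<le> s" "s \<le> h" "0 \<le> t" "t \<le> h" for s t
      using inS[of t s] that by (simp add: ac_simps)
    obtain s' t' where st': "0 < s'" "s' < h" "0 < t'" "t' < h"
      "f (x + h *\<^sub>R v + h *\<^sub>R u) - f (x + h *\<^sub>R v) - (f (x + h *\<^sub>R u) - f x)
      = h * (h * b (x + s' *\<^sub>R v + t' *\<^sub>R u))"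
      unfolding b_def by (rule second_difference[OF assms(2) h inS'])
    have "h * (h * a (x + s *\<^sub>R u + t *\<^sub>R v)) = h * (h * b (x + t' *\<^sub>R u + s' *\<^sub>R v))"
      using st(5) st'(5)[unfolded add.assoc[of x] add.commute[of "h *\<^sub>R v"] add.commute[of "s' *\<^sub>R v"]]
      by (simp only: add.assoc)
    then have "a (x + s *\<^sub>R u + t *\<^sub>R v) = b (x + t' *\<^sub>R u + s' *\<^sub>R v)" using h by simp
    moreover have "dist (a (x + s *\<^sub>R u + t *\<^sub>R v)) (a x) < e/2"
      using st near[of s t] inS[of s t] by (intro d2) (auto simp: d_def)
    moreover have "dist (b (x + t' *\<^sub>R u + s' *\<^sub>R v)) (b x) < e/2"
      using st' near[of t' s'] inS[of t' s'] by (intro d3) (auto simp: d_def)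
    ultimately show ?thesis unfolding dist_real_def by linarith
  qed
  then have "\<bar>a x - b x\<bar> \<le> 0" by (rule field_le_epsilon) simp
  then show ?thesis by (simp add: a_def b_def)
qed

text \<open>The direction comes first and the point last, so that \<open>dir_deriv a f\<close> is
  again a function of the point and derivatives can be iterated.\<close>

definition dir_deriv :: "'a::real_normed_vector \<Rightarrow> ('a \<Rightarrow> 'b::real_normed_vector) \<Rightarrow> 'a \<Rightarrow> 'b"
  where "dir_deriv a f z = frechet_derivative f (at z) a"

lemma dir_deriv_eq: "(f has_derivative f') (at z) \<Longrightarrow> dir_deriv a f z = f' a"
  by (metis dir_deriv_def frechet_derivative_at)

lemma smooth_on_dir_deriv: "smooth_on S f \<Longrightarrow> smooth_on S (dir_deriv a f)"
  using smooth_on_frechet[of S f a] by (simp add: dir_deriv_def[abs_def])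

lemma smooth_on_has_dir_deriv:
  "smooth_on S f \<Longrightarrow> z \<in> S \<Longrightarrow> (f has_derivative (\<lambda>a. dir_deriv a f z)) (at z)"
  using smooth_on_has_derivative[of S f z] by (simp add: dir_deriv_def)

lemma dir_deriv_cong:
  assumes "open S" "z \<in> S" "\<And>z. z \<in> S \<Longrightarrow> f z = g z" "f differentiable at z"
  shows "dir_deriv a f z = dir_deriv a g z"
  unfolding dir_deriv_def
  by (subst frechet_derivative_transform_within_open[of f z S g]) (use assms in auto)

lemma linear_dir_deriv: "smooth_on S f \<Longrightarrow> z \<in> S \<Longrightarrow> linear (\<lambda>a. dir_deriv a f z)"
  by (rule has_derivative_linear) (rule smooth_on_has_dir_deriv)

lemma dir_deriv_commute:
  fixes f :: "'a::euclidean_space \<Rightarrow> real"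
  assumes "open S" "smooth_on S f" "x \<in> S"
  shows "dir_deriv a (dir_deriv b f) x = dir_deriv b (dir_deriv a f) x"
  using frechet_derivative_commute[OF assms] by (simp add: dir_deriv_def[abs_def])

lemma dir_deriv_line:
  assumes "smooth_on S f" "z + s *\<^sub>R w \<in> S"
  shows "((\<lambda>t. f (z + t *\<^sub>R w)) has_vector_derivative dir_deriv w f (z + s *\<^sub>R w)) (at s)"
  unfolding dir_deriv_def
  by (rule has_derivative_along_line[OF smooth_on_has_derivative[OF assms]])

lemma dir_deriv_curve:
  assumes f: "smooth_on S f" "c t \<in> S" and c: "(c has_vector_derivative c') (at t)"
  shows "((\<lambda>s. f (c s)) has_vector_derivative dir_deriv c' f (c t)) (at t)"
  using has_derivative_compose[OF c[unfolded has_vector_derivative_def] smooth_on_has_dir_deriv[OF f]]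
    linear_scale[OF linear_dir_deriv[OF f]]
  by (simp add: has_vector_derivative_def)

text \<open>A product rule: the derivative is linear in its direction, so expansion of
  \<open>Y s\<close> in the basis separates the motion of the direction from that of the base point.
  The expansion is valid only inside \<open>S\<close>, hence eventually near
  \<open>t\<close>.\<close>

lemma dir_deriv_moving:
  assumes f: "open S" "smooth_on S f" "c t \<in> S"
    and c: "(c has_vector_derivative c') (at t)" and Y: "(Y has_vector_derivative Y') (at t)"
  shows "((\<lambda>s. dir_deriv (Y s) f (c s)) has_vector_derivative
    dir_deriv Y' f (c t) + dir_deriv c' (dir_deriv (Y t) f) (c t)) (at t)"
proof -
  have basis: "dir_deriv y f z = (\<Sum>b\<in>Basis. (y \<bullet> b) *\<^sub>R dir_deriv b f z)" if "z \<in> S" for y z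
    by (rule linear_basis_expansion[OF linear_dir_deriv[OF f(2) that]])
  have d: "((\<lambda>s. dir_deriv b f (c s)) has_vector_derivative dir_deriv c' (dir_deriv b f) (c t)) (at t)" for b
    by (rule dir_deriv_curve[OF smooth_on_dir_deriv[OF f(2)] f(3) c])
  have Yb: "((\<lambda>s. Y s \<bullet> b) has_vector_derivative Y' \<bullet> b) (at t)" for b
    by (rule bounded_linear.has_vector_derivative[OF bounded_linear_inner_left Y])
  have "((\<lambda>z. \<Sum>b\<in>Basis. (Y t \<bullet> b) *\<^sub>R dir_deriv b f z) has_derivative
      (\<lambda>a. \<Sum>b\<in>Basis. (Y t \<bullet> b) *\<^sub>R dir_deriv a (dir_deriv b f) (c t))) (at (c t))"
    by (intro has_derivative_sum has_derivative_scaleR_right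
        smooth_on_has_dir_deriv[OF smooth_on_dir_deriv[OF f(2)] f(3)])
  then have "(dir_deriv (Y t) f has_derivative
      (\<lambda>a. \<Sum>b\<in>Basis. (Y t \<bullet> b) *\<^sub>R dir_deriv a (dir_deriv b f) (c t))) (at (c t))"
    by (rule has_derivative_transform_within_open[OF _ f(1,3)]) (rule basis[symmetric])
  then have e: "dir_deriv c' (dir_deriv (Y t) f) (c t)
      = (\<Sum>b\<in>Basis. (Y t \<bullet> b) *\<^sub>R dir_deriv c' (dir_deriv b f) (c t))"
    by (rule dir_deriv_eq)
  have "((\<lambda>s. \<Sum>b\<in>Basis. (Y s \<bullet> b) *\<^sub>R dir_deriv b f (c s)) has_vector_derivative
    (\<Sum>b\<in>Basis. (Y t \<bullet> b) *\<^sub>R dir_deriv c' (dir_deriv b f) (c t) + (Y' \<bullet> b) *\<^sub>R dir_deriv b f (c t))) (at t)"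
    by (intro has_vector_derivative_sum has_vector_derivative_scaleR d)
       (simp add: Yb has_real_derivative_iff_has_vector_derivative)
  then have *: "((\<lambda>s. \<Sum>b\<in>Basis. (Y s \<bullet> b) *\<^sub>R dir_deriv b f (c s)) has_vector_derivative
    (dir_deriv Y' f (c t) + dir_deriv c' (dir_deriv (Y t) f) (c t))) (at t)"
    unfolding e basis[OF f(3), of Y'] by (simp only: sum.distrib add.commute)
  have "isCont c t" using c by (rule has_vector_derivative_continuous)
  then have "\<forall>\<^sub>F s in at t. c s \<in> S" using f(1,3) by (simp add: continuous_at topological_tendstoD)
  then have ev: "\<forall>\<^sub>F s in at t. (\<Sum>b\<in>Basis. (Y s \<bullet> b) *\<^sub>R dir_deriv b f (c s)) = dir_deriv (Y s) f (c s)"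
    by eventually_elim (rule basis[symmetric])
  show ?thesis
    using * unfolding has_vector_derivative_def
    by (rule has_derivative_transform_eventually[OF _ ev basis[OF f(3), symmetric] UNIV_I])
qed

lemma dir_deriv_line_moving:
  assumes "open S" "smooth_on S f" "z \<in> S"
  shows "((\<lambda>t. dir_deriv (a0 + t *\<^sub>R a1) f (z + t *\<^sub>R w)) has_vector_derivative
    dir_deriv a1 f z + dir_deriv w (dir_deriv a0 f) z) (at 0)"
proof -
  have "((\<lambda>t. b + t *\<^sub>R a) has_vector_derivative a) (at 0)" for a b :: 'a
    by (auto intro!: derivative_eq_intros)
  from dir_deriv_moving[OF assms(1,2) _ this[of z w] this[of a0 a1]] show ?thesis
    using assms(3) by simp
qed

section \<open>Local existence for ordinary differential equations\<close>

text \<open>Banach's fixed point theorem for the integral operator on bounded continuous functions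
  on the whole line, a complete space that is available as a type.\<close>

lemma picard_lindeloef_global:
  fixes W :: "'a::euclidean_space \<Rightarrow> 'a"
  assumes W: "L-lipschitz_on UNIV W"
  obtains e c where "0 < e" "c 0 = x0" "continuous_on UNIV c"
    "\<And>t. t \<in> {-e<..<e} \<Longrightarrow> (c has_vector_derivative W (c t)) (at t)"
proof -
  have L: "0 \<le> L" using W by (rule lipschitz_on_nonneg)
  \<comment> \<open>Two integrals over intervals of length at most 2e are estimated below, so 4eL
    bounds the contraction factor; this \<open>e\<close> makes it at most 1/2, also when L =
    0.\<close>
  define e where "e = 1 / (8 * (L + 1))"
  have e: "0 < e" using L by (simp add: e_def)
  have eL: "4 * e * L \<le> 1 / 2" using L by (simp add: e_def divide_simps)
  \<comment> \<open>Clamping time to [-e, e] extends the integral operator to functions on the whole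
    line and keeps its values bounded.\<close>
  define cl where "cl = (\<lambda>t::real. max (-e) (min e t))"
  have cl: "cl t \<in> {-e..e}" for t using e by (auto simp: cl_def)
  have cont_cl: "continuous_on UNIV cl" unfolding cl_def by (intro continuous_intros)
  have cont_W: "continuous_on UNIV W" using W by (rule lipschitz_on_continuous_on)
  \<comment> \<open>The integral from 0 to \<open>cl t\<close> is written as a difference of
    integrals from -e, which covers negative times as well.\<close>
  define P where "P = (\<lambda>X::real \<Rightarrow>\<^sub>C 'a. \<lambda>t. x0 + integral {-e..cl t} (\<lambda>s. W (X s))
    - integral {-e..0} (\<lambda>s. W (X s)))"
  have cont_WX: "continuous_on T (\<lambda>s. W (apply_bcontfun X s))" for T and X :: "real \<Rightarrow>\<^sub>C 'a"
    by (rule continuous_on_compose2[OF cont_W]) auto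
  have cont_I: "continuous_on {-e..e} (\<lambda>t. integral {-e..t} (\<lambda>s. W (apply_bcontfun X s)))"
    for X :: "real \<Rightarrow>\<^sub>C 'a"
    by (intro indefinite_integral_continuous_1 integrable_continuous_real cont_WX)
  have PX: "P X \<in> bcontfun" for X
  proof -
    have "continuous_on UNIV (P X)" unfolding P_def
      by (intro continuous_intros continuous_on_compose2[OF cont_I cont_cl]) (use cl in auto)
    moreover have "bounded (range (P X))"
    proof -
      have "bounded ((\<lambda>t. x0 + integral {-e..t} (\<lambda>s. W (X s)) - integral {-e..0} (\<lambda>s. W (X s))) ` {-e..e})"
        by (intro compact_imp_bounded compact_continuous_image continuous_intros cont_I) auto
      then show ?thesis by (rule bounded_subset) (use cl in \<open>auto simp: P_def\<close>)
    qed
    ultimately show ?thesis by (simp add: bcontfun_def)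
  qed
  define Q where "Q = (\<lambda>X. Bcontfun (P X))"
  have Q: "apply_bcontfun (Q X) = P X" for X
    by (simp add: Q_def Bcontfun_inverse PX)
  have contr: "dist (Q X) (Q Y) \<le> 1/2 * dist X Y" for X Y
  proof (rule dist_bound)
    fix t
    let ?d = "\<lambda>s. W (X s) - W (Y s)"
    have d: "norm (?d s) \<le> L * dist X Y" for s
    proof -
      have "norm (?d s) \<le> L * norm (X s - Y s)"
        using lipschitz_on_normD[OF W] by simp
      also have "\<dots> \<le> L * dist X Y"
        using L dist_bounded[of X s Y] by (intro mult_left_mono) (simp_all add: dist_norm)
      finally show ?thesis .
    qed
    have I: "norm (integral {-e..b} ?d) \<le> 2 * e * L * dist X Y" if "b \<in> {-e..e}" for b
    proof -
      have "norm (integral {-e..b} ?d) \<le> L * dist X Y * (b - (-e))"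
        using that d by (intro integral_bound continuous_intros cont_WX) auto
      also have "\<dots> \<le> L * dist X Y * (2 * e)"
        using that L by (intro mult_left_mono) auto
      finally show ?thesis by (simp add: ac_simps)
    qed
    have "P X t - P Y t = integral {-e..cl t} ?d - integral {-e..0} ?d"
      unfolding P_def
      by (simp add: Henstock_Kurzweil_Integration.integral_diff integrable_continuous_real cont_WX)
    then have "dist (P X t) (P Y t) \<le> norm (integral {-e..cl t} ?d) + norm (integral {-e..0} ?d)"
      by (simp add: dist_norm norm_triangle_ineq4)
    also have "\<dots> \<le> 4 * e * L * dist X Y"
      using I[of "cl t"] I[of 0] cl[of t] e by simp
    also have "\<dots> \<le> 1/2 * dist X Y" using eL by (intro mult_right_mono) auto
    finally show "dist (Q X t) (Q Y t) \<le> 1/2 * dist X Y" by (simp add: Q)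
  qed
  have "\<exists>!X. Q X = X"
    by (rule banach_fix_type[where c="1/2"]) (use contr in simp_all)
  then obtain X where X: "Q X = X" by (elim ex1E)
  have fix': "X t = P X t" for t using Q[of X] X by simp
  show thesis
  proof (rule that[OF e])
    show "X 0 = x0" using fix'[of 0] e by (simp add: P_def cl_def)
    show "continuous_on UNIV (apply_bcontfun X)" by simp
    fix t assume t: "t \<in> {-e<..<e}"
    have "((\<lambda>t. integral {-e..t} (\<lambda>s. W (X s))) has_vector_derivative W (X t)) (at t within {-e..e})"
      using t by (intro integral_has_vector_derivative cont_WX) auto
    then have "((\<lambda>t. integral {-e..t} (\<lambda>s. W (X s))) has_vector_derivative W (X t)) (at t)"
      using t by (subst (asm) at_within_interior) (auto simp: interior_atLeastAtMost_real)
    then have d: "((\<lambda>t. x0 + integral {-e..t} (\<lambda>s. W (X s)) - integral {-e..0} (\<lambda>s. W (X s)))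
        has_vector_derivative W (X t)) (at t)"
      by (auto intro!: derivative_eq_intros)
    have eq: "x0 + integral {-e..s} (\<lambda>s. W (X s)) - integral {-e..0} (\<lambda>s. W (X s)) = X s"
      if "s \<in> {-e<..<e}" for s
    proof -
      have "cl s = s" using that by (simp add: cl_def)
      then show ?thesis using fix'[of s] by (simp only: P_def)
    qed
    show "(X has_vector_derivative W (X t)) (at t)"
      by (rule has_vector_derivative_transform_within_open[OF d open_greaterThanLessThan t eq])
  qed
qed

text \<open>On a closed ball the derivative of \<open>W\<close> is bounded, so \<open>W\<close> is
  Lipschitz there. Composition with the nearest-point projection, which is 1-Lipschitz, gives a
  globally Lipschitz field equal to \<open>W\<close> on the ball, and a solution stays in the ball
  for a short time by continuity.\<close>

theorem picard_lindeloef: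
  fixes W :: "'a::euclidean_space \<Rightarrow> 'a"
  assumes "open S" "smooth_on S W" "x0 \<in> S"
  obtains e c where "0 < e" "c 0 = x0"
    "\<And>t. t \<in> {-e<..<e} \<Longrightarrow> c t \<in> S \<and> (c has_vector_derivative W (c t)) (at t)"
proof -
  obtain r where r: "0 < r" "cball x0 r \<subseteq> S" using assms by (meson open_contains_cball)
  let ?B = "cball x0 r"
  have "\<exists>M. \<forall>x\<in>?B. norm (frechet_derivative W (at x) b) \<le> M" for b
  proof -
    have "continuous_on ?B (\<lambda>x. frechet_derivative W (at x) b)"
      using r smooth_on_continuous[OF smooth_on_frechet[OF assms(2)]] continuous_on_subset by blast
    then have "bounded ((\<lambda>x. frechet_derivative W (at x) b) ` ?B)"
      by (intro compact_imp_bounded compact_continuous_image) auto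
    then show ?thesis by (auto simp: bounded_iff)
  qed
  then obtain M where M: "\<And>b x. x \<in> ?B \<Longrightarrow> norm (frechet_derivative W (at x) b) \<le> M b"
    by metis
  define K where "K = (\<Sum>b\<in>Basis. M b)"
  have "dist (W x) (W y) \<le> K * dist x y" if "x \<in> ?B" "y \<in> ?B" for x y
    unfolding dist_norm
  proof (rule differentiable_bound[OF _ _ _ that])
    show "convex ?B" by simp
    fix z assume z: "z \<in> ?B"
    have der: "(W has_derivative frechet_derivative W (at z)) (at z)"
      using z r by (intro smooth_on_has_derivative[OF assms(2)]) auto
    then show "(W has_derivative frechet_derivative W (at z)) (at z within ?B)"
      by (rule has_derivative_at_withinI)
    have lin: "linear (frechet_derivative W (at z))" using der by (rule has_derivative_linear)
    show "onorm (frechet_derivative W (at z)) \<le> K"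
    proof (rule onorm_le)
      fix v
      have "frechet_derivative W (at z) v = (\<Sum>b\<in>Basis. (v \<bullet> b) *\<^sub>R frechet_derivative W (at z) b)"
        by (rule linear_basis_expansion[OF lin])
      also have "norm \<dots> \<le> (\<Sum>b\<in>Basis. norm v * M b)"
        by (rule sum_norm_le) (use M[OF z] Basis_le_norm in \<open>auto intro!: mult_mono\<close>)
      finally show "norm (frechet_derivative W (at z) v) \<le> K * norm v"
        by (simp add: K_def sum_distrib_left mult.commute)
    qed
  qed
  moreover have "0 \<le> K"
    unfolding K_def using M[of x0] r by (intro sum_nonneg) (meson centre_in_cball less_imp_le norm_ge_zero order_trans)
  ultimately have lip: "K-lipschitz_on ?B W" by (intro lipschitz_onI)
  let ?p = "closest_point ?B"
  have ball: "convex ?B" "closed ?B" "?B \<noteq> {}" using r by auto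
  have pB: "?p x \<in> ?B" for x by (intro closest_point_in_set ball)
  have "K-lipschitz_on UNIV (\<lambda>x. W (?p x))"
  proof (rule lipschitz_onI)
    fix x y
    have "dist (W (?p x)) (W (?p y)) \<le> K * dist (?p x) (?p y)"
      by (rule lipschitz_onD[OF lip pB pB])
    also have "\<dots> \<le> K * dist x y"
      using \<open>0 \<le> K\<close> closest_point_lipschitz[OF ball] by (intro mult_left_mono)
    finally show "dist (W (?p x)) (W (?p y)) \<le> K * dist x y" .
  qed fact
  from picard_lindeloef_global[OF this, where ?x0.0=x0] obtain e c
    where e: "0 < e" and c: "c 0 = x0" "continuous_on UNIV c"
    "\<And>t. t \<in> {-e<..<e} \<Longrightarrow> (c has_vector_derivative W (?p (c t))) (at t)"
    by metis
  have "open (c -` ball x0 r)" using c(2) by (simp add: continuous_open_vimage continuous_on_eq_continuous_at)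
  moreover have "0 \<in> c -` ball x0 r" using c(1) r by simp
  ultimately obtain d where d: "0 < d" "ball 0 d \<subseteq> c -` ball x0 r" by (meson open_contains_ball)
  show thesis
  proof (rule that[of "min d e" c])
    show "0 < min d e" using d e by simp
    show "c 0 = x0" by fact
    fix t assume t: "t \<in> {- min d e<..<min d e}"
    then have "t \<in> ball 0 d" by (auto simp: dist_real_def)
    with d(2) have ct: "c t \<in> ?B" by (auto intro: less_imp_le)
    then have "?p (c t) = c t" by (rule closest_point_self)
    with c(3)[of t] t have "(c has_vector_derivative W (c t)) (at t)" by auto
    with ct r(2) show "c t \<in> S \<and> (c has_vector_derivative W (c t)) (at t)" by blast
  qed
qed

text \<open>Bootstrapping: if \<open>c\<close> is \<open>Ck\<close>, then so is its derivative
  \<open>W (c t)\<close>, and \<open>c\<close> gains one order.\<close>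

lemma smooth_on_solution:
  fixes W :: "'a::euclidean_space \<Rightarrow> 'a"
  assumes "open S" "smooth_on S W" "open J"
    and c: "\<And>t. t \<in> J \<Longrightarrow> c t \<in> S \<and> (c has_vector_derivative W (c t)) (at t)"
  shows "smooth_on J c"
proof -
  have "Ck_on k c J" for k
  proof (induction k)
    case 0
    show ?case using c by (auto intro: continuous_at_imp_continuous_on has_vector_derivative_continuous)
  next
    case (Suc k)
    have "Ck_on k (\<lambda>t. W (c t)) J"
      by (rule Ck_on_comp[OF assms(3,1)]) (use c Suc assms(2) in \<open>auto simp: smooth_on_def\<close>)
    then show ?case
      using c by (intro Ck_on_SucI[OF assms(3), where f'="\<lambda>t r. r *\<^sub>R W (c t)"]
          Ck_on_bilinear[OF bounded_bilinear_scaleR assms(3)] Ck_on_const)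
        (auto simp: has_vector_derivative_def)
  qed
  then show ?thesis by (simp add: smooth_on_def)
qed

section \<open>Berwald structures in a chart\<close>

text \<open>An injective \<open>A0\<close> is bounded below by some \<open>l\<close>. Once
  \<open>A z\<close> is within l/2 of \<open>A0\<close> it is bounded below by l/2, which controls
  \<open>d z - d0\<close> by the residual \<open>c z - A z d0\<close>. This replaces continuity of
  the inverse matrix.\<close>

lemma tendsto_linear_solution:
  fixes A :: "'z \<Rightarrow> 'a::euclidean_space \<Rightarrow> 'b::euclidean_space"
  assumes lin: "\<forall>\<^sub>F z in F. linear (A z)" and A: "\<And>b. ((\<lambda>z. A z b) \<longlongrightarrow> A0 b) F"
    and A0: "linear A0" "inj A0"
    and sol: "\<forall>\<^sub>F z in F. A z (d z) = c z" and c: "(c \<longlongrightarrow> A0 d0) F"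
  shows "(d \<longlongrightarrow> d0) F"
proof -
  obtain l where l: "0 < l" "\<And>v. l * norm v \<le> norm (A0 v)"
    using linear_inj_bounded_below_pos[OF A0] by blast
  define e where "e = (\<lambda>z. \<Sum>b\<in>Basis. norm (A z b - A0 b))"
  have "((\<lambda>z. \<Sum>b\<in>Basis. norm (A z b - A0 b)) \<longlongrightarrow> (\<Sum>b\<in>Basis. norm (A0 b - A0 b))) F"
    by (intro tendsto_intros A)
  then have "(e \<longlongrightarrow> 0) F" by (simp add: e_def)
  then have small: "\<forall>\<^sub>F z in F. e z < l / 2" using l(1) by (intro order_tendstoD) auto
  have bound: "norm (d z - d0) \<le> 2 / l * norm (c z - A z d0)"
    if "linear (A z)" "A z (d z) = c z" "e z < l / 2" for z
  proof -
    let ?v = "d z - d0"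
    have "A z ?v - A0 ?v = (\<Sum>b\<in>Basis. (?v \<bullet> b) *\<^sub>R (A z b - A0 b))"
      using linear_basis_expansion[OF that(1), of ?v] linear_basis_expansion[OF A0(1), of ?v]
      by (simp add: sum_subtractf scaleR_diff_right)
    also have "norm \<dots> \<le> (\<Sum>b\<in>Basis. norm ?v * norm (A z b - A0 b))"
      by (rule sum_norm_le) (auto intro!: mult_right_mono simp: Basis_le_norm)
    finally have "norm (A z ?v - A0 ?v) \<le> norm ?v * e z" by (simp add: e_def sum_distrib_left)
    also have "\<dots> \<le> norm ?v * (l / 2)" using that(3) by (intro mult_left_mono) auto
    finally have "norm (A z ?v - A0 ?v) \<le> l / 2 * norm ?v" by (simp add: mult.commute)
    then have "l * norm ?v \<le> norm (A z ?v) + l / 2 * norm ?v"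
      using l(2)[of ?v] norm_triangle_ineq2[of "A0 ?v" "A z ?v"] by (simp add: norm_minus_commute)
    moreover have "A z ?v = c z - A z d0" using that by (simp add: linear_diff)
    ultimately show ?thesis using l(1) by (simp add: field_simps)
  qed
  have "((\<lambda>z. 2 / l * norm (c z - A z d0)) \<longlongrightarrow> 2 / l * norm (A0 d0 - A0 d0)) F"
    by (intro tendsto_intros A c)
  then have lim: "((\<lambda>z. 2 / l * norm (c z - A z d0)) \<longlongrightarrow> 0) F" by simp
  have "\<forall>\<^sub>F z in F. norm (d z - d0) \<le> 2 / l * norm (c z - A z d0)"
    using lin sol small by eventually_elim (rule bound)
  then have "((\<lambda>z. d z - d0) \<longlongrightarrow> 0) F" by (rule Lim_null_comparison[OF _ lim])
  then show ?thesis by (rule Lim_null[THEN iffD2])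
qed

text \<open>This is the Gram operator of \<open>B\<close>: a vector \<open>v\<close> in its kernel
  satisfies \<open>B v v = 0\<close>. It turns equations tested against all vectors into linear
  systems.\<close>

lemma pos_def_representation:
  fixes B :: "'a::euclidean_space \<Rightarrow> 'a \<Rightarrow> real"
  assumes B: "bilinear B" "\<And>v. v \<noteq> 0 \<Longrightarrow> 0 < B v v"
  shows "linear (\<lambda>v. \<Sum>b\<in>Basis. B v b *\<^sub>R b)" "inj (\<lambda>v. \<Sum>b\<in>Basis. B v b *\<^sub>R b)"
proof -
  let ?A = "\<lambda>v. \<Sum>b\<in>Basis. B v b *\<^sub>R b"
  show lin: "linear ?A"
    by (intro linearI)
       (simp_all add: bilinear_ladd[OF B(1)] bilinear_lmul[OF B(1)] scaleR_add_left sum.distrib scaleR_sum_right)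
  have "v = 0" if "?A v = 0" for v
  proof (rule ccontr)
    assume "v \<noteq> 0"
    have "B v b = 0" if "b \<in> Basis" for b
      using arg_cong[OF \<open>?A v = 0\<close>, of "\<lambda>a. a \<bullet> b"] that
      by (simp add: inner_sum_left inner_Basis if_distrib sum.delta cong: if_cong)
    moreover have "linear (B v)" using B(1) by (simp add: bilinear_def)
    ultimately have "B v v = 0" by (simp add: linear_basis_expansion[of "B v" v])
    with B(2)[OF \<open>v \<noteq> 0\<close>] show False by simp
  qed
  then show "inj ?A" using lin by (simp add: linear_injective_0)
qed

text \<open>The second factor need not be differentiable because the first one vanishes at \<open>x\<close>.\<close>

lemma has_derivative_scaleR_zero:
  fixes f :: "'a::real_normed_vector \<Rightarrow> real"
  assumes f: "(f has_derivative f') (at x)" "f x = 0" and g: "isCont g x"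
  shows "((\<lambda>z. f z *\<^sub>R g z) has_derivative (\<lambda>h. f' h *\<^sub>R g x)) (at x)"
proof -
  have lin: "bounded_linear f'" using f(1) by (rule has_derivative_bounded_linear)
  have 1: "((\<lambda>z. f z *\<^sub>R g x) has_derivative (\<lambda>h. f' h *\<^sub>R g x)) (at x)"
    using f(1) by (auto intro!: derivative_eq_intros)
  have "((\<lambda>z. f z *\<^sub>R (g z - g x)) has_derivative (\<lambda>h. 0)) (at x)"
  proof -
    obtain M where M: "\<forall>h. norm (f' h) \<le> norm h * M" using lin bounded_linear.bounded by blast
    have fq: "((\<lambda>z. norm (f z - f x - f' (z - x)) / norm (z - x)) \<longlongrightarrow> 0) (at x)"
      using f(1) by (simp add: has_derivative_iff_norm)
    have g0: "((\<lambda>z. norm (g z - g x)) \<longlongrightarrow> 0) (at x)"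
      using g by (simp add: isCont_def LIM_zero tendsto_norm_zero)
    have "((\<lambda>z. (norm (f z - f x - f' (z - x)) / norm (z - x) + \<bar>M\<bar>) * norm (g z - g x)) \<longlongrightarrow> (0 + \<bar>M\<bar>) * 0) (at x)"
      by (intro tendsto_intros fq g0)
    then have lim: "((\<lambda>z. (norm (f z - f x - f' (z - x)) / norm (z - x) + \<bar>M\<bar>) * norm (g z - g x)) \<longlongrightarrow> 0) (at x)"
      by (simp only: mult_zero_right)
    have "((\<lambda>z. norm (f z *\<^sub>R (g z - g x)) / norm (z - x)) \<longlongrightarrow> 0) (at x)"
    proof (rule Lim_null_comparison[OF _ lim])
      have "norm (f z *\<^sub>R (g z - g x)) / norm (z - x)
        \<le> (norm (f z - f x - f' (z - x)) / norm (z - x) + \<bar>M\<bar>) * norm (g z - g x)" if "z \<noteq> x" for z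
      proof -
        have "\<bar>f z\<bar> \<le> norm (f z - f x - f' (z - x)) + norm (f' (z - x))"
          using f(2) by simp
        also have "norm (f' (z - x)) \<le> \<bar>M\<bar> * norm (z - x)"
          using M[rule_format, of "z - x"] abs_ge_self[of M] mult_right_mono[of M "\<bar>M\<bar>" "norm (z - x)"]
          by (simp add: mult.commute)
        finally have "\<bar>f z\<bar> / norm (z - x) \<le> norm (f z - f x - f' (z - x)) / norm (z - x) + \<bar>M\<bar>"
          using that by (simp add: divide_simps)
        from mult_right_mono[OF this norm_ge_zero[of "g z - g x"]] show ?thesis by simp
      qed
      then show "\<forall>\<^sub>F z in at x. norm (norm (f z *\<^sub>R (g z - g x)) / norm (z - x))
        \<le> (norm (f z - f x - f' (z - x)) / norm (z - x) + \<bar>M\<bar>) * norm (g z - g x)"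
        by (auto simp: eventually_at_filter)
    qed
    then show ?thesis using f(2) by (simp add: has_derivative_iff_norm)
  qed
  from has_derivative_add[OF 1 this] show ?thesis
    by (simp add: scaleR_diff_right)
qed

text \<open>Identities valid off the zero section may be differentiated along a vertical line at t =
  0, because the line avoids 0 for all parameters in this neighbourhood.\<close>

lemma open_line_nonzero:
  fixes y w :: "'a::real_normed_vector"
  assumes "y \<noteq> 0"
  shows "open {t. y + t *\<^sub>R w \<noteq> 0}" "0 \<in> {t. y + t *\<^sub>R w \<noteq> 0}"
proof -
  have "open ((\<lambda>t. y + t *\<^sub>R w) -` (- {0}))"
    by (intro continuous_open_vimage) (auto intro!: continuous_intros)
  then show "open {t. y + t *\<^sub>R w \<noteq> 0}" by (simp add: vimage_def)
qed (use assms in simp)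

text \<open>Here \<open>L\<close> is \<open>F\<^sup>2/2\<close> as a function of the induced coordinates \<open>(x, y)\<close> of the tangent bundle,
  so \<open>(0, a)\<close> is a vertical direction; \<open>H\<close> below is the fundamental tensor and \<open>T\<close> twice the
  Cartan tensor.\<close>

locale berwald_chart =
  fixes S :: "'e::euclidean_space set" and L :: "'e \<times> 'e \<Rightarrow> real"
    and \<Gamma> :: "'e \<Rightarrow> 'e \<Rightarrow> 'e \<Rightarrow> 'e"
  assumes open_S: "open S"
    and smooth_L: "smooth_on (S \<times> (UNIV - {0})) L"
    and L_scale: "\<And>x y l. x \<in> S \<Longrightarrow> y \<noteq> 0 \<Longrightarrow> 0 < l \<Longrightarrow> L (x, l *\<^sub>R y) = l\<^sup>2 * L (x, y)"
    and L_pos: "\<And>x y u. x \<in> S \<Longrightarrow> y \<noteq> 0 \<Longrightarrow> u \<noteq> 0 \<Longrightarrow>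
      0 < dir_deriv (0, u) (dir_deriv (0, u) L) (x, y)"
    and bilinear_\<Gamma>: "\<And>x. x \<in> S \<Longrightarrow> bilinear (\<Gamma> x)"
    and \<Gamma>_commute: "\<And>x u w. x \<in> S \<Longrightarrow> \<Gamma> x u w = \<Gamma> x w u"
    and smooth_\<Gamma>: "\<And>u w. smooth_on S (\<lambda>x. \<Gamma> x u w)"
    and L_parallel: "\<And>x y u. x \<in> S \<Longrightarrow> y \<noteq> 0 \<Longrightarrow> dir_deriv (u, - \<Gamma> x u y) L (x, y) = 0"
begin

abbreviation slit :: "('e \<times> 'e) set" where "slit \<equiv> S \<times> (UNIV - {0})"

definition H :: "'e \<times> 'e \<Rightarrow> 'e \<Rightarrow> 'e \<Rightarrow> real" where
  "H z a b = dir_deriv (0, a) (dir_deriv (0, b) L) z"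

definition T :: "'e \<times> 'e \<Rightarrow> 'e \<Rightarrow> 'e \<Rightarrow> 'e \<Rightarrow> real" where
  "T z a b c = dir_deriv (0, a) (\<lambda>z. H z b c) z"

section \<open>Symmetry and linearity of the vertical derivatives\<close>

lemma open_slit: "open slit"
  by (intro open_Times open_S) auto

lemma smooth_H: "smooth_on slit (\<lambda>z. H z a b)"
  unfolding H_def by (intro smooth_on_dir_deriv smooth_L)

lemma H_commute: "z \<in> slit \<Longrightarrow> H z a b = H z b a"
  unfolding H_def by (rule dir_deriv_commute[OF open_slit smooth_L])

lemma linear_vertical:
  fixes f :: "'e \<times> 'e \<Rightarrow> real"
  assumes "smooth_on slit f" "z \<in> slit"
  shows "linear (\<lambda>a. dir_deriv (0, a) f z)"
  using linear_compose[OF _ linear_dir_deriv[OF assms], of "\<lambda>a. (0, a)"]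
  by (simp add: o_def linear_iff)

lemma bilinear_H: assumes "z \<in> slit" shows "bilinear (H z)"
proof -
  have l: "linear (\<lambda>a. H z a b)" for b
    unfolding H_def by (rule linear_vertical[OF smooth_on_dir_deriv[OF smooth_L] assms])
  then have "linear (\<lambda>b. H z a b)" for a
    by (simp add: H_commute[OF assms, of a])
  with l show ?thesis by (simp add: bilinear_def)
qed

lemma H_pos: "z \<in> slit \<Longrightarrow> u \<noteq> 0 \<Longrightarrow> 0 < H z u u"
  unfolding H_def using L_pos by auto

lemma H_nondegenerate:
  assumes "z \<in> slit" "\<And>y. H z a y = H z b y" shows "a = b"
proof (rule ccontr)
  assume "a \<noteq> b"
  then have "0 < H z (a - b) (a - b)" by (intro H_pos assms) simp
  also have "\<dots> = 0" using assms(2) by (simp add: bilinear_lsub[OF bilinear_H[OF assms(1)]])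
  finally show False by simp
qed

lemma T_commute12: "z \<in> slit \<Longrightarrow> T z a b c = T z b a c"
  unfolding T_def H_def
  by (rule dir_deriv_commute[OF open_slit smooth_on_dir_deriv[OF smooth_L]])

lemma T_commute23: "z \<in> slit \<Longrightarrow> T z a b c = T z a c b"
  unfolding T_def
  by (rule dir_deriv_cong[OF open_slit _ H_commute])
     (auto intro: differentiableI smooth_on_has_dir_deriv[OF smooth_H])

lemma linear_T1: "z \<in> slit \<Longrightarrow> linear (\<lambda>a. T z a b c)"
  unfolding T_def by (rule linear_vertical[OF smooth_H])

lemma linear_T2: "z \<in> slit \<Longrightarrow> linear (\<lambda>b. T z a b c)"
  using linear_T1[of z a c] T_commute12[of z] by simp

lemma linear_T3: "z \<in> slit \<Longrightarrow> linear (\<lambda>c. T z a b c)"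
  using linear_T2[of z a b] T_commute23[of z] by simp

text \<open>\<open>L_parallel\<close> says that \<open>L\<close> is constant in the horizontal
  direction (u, -\<open>\<Gamma> x u y\<close>). Solving for the base derivative gives a form that
  can be differentiated vertically.\<close>

lemma horizontal:
  assumes "x \<in> S" "y \<noteq> 0"
  shows "dir_deriv (u, 0) L (x, y) = dir_deriv (0, \<Gamma> x u y) L (x, y)"
proof -
  have "linear (\<lambda>a. dir_deriv a L (x, y))"
    by (rule linear_dir_deriv[OF smooth_L]) (use assms in auto)
  from linear_diff[OF this, of "(u, 0)" "(0, \<Gamma> x u y)"] show ?thesis
    using L_parallel[OF assms, of u] by simp
qed

text \<open>Vertical derivative of \<open>horizontal\<close> along y + t w. The direction
  \<open>\<Gamma> x u (y + t w)\<close> on the right also moves with t, which produces the first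
  term.\<close>

lemma horizontal_vertical:
  assumes "x \<in> S" "y \<noteq> 0"
  shows "dir_deriv (0, w) (dir_deriv (u, 0) L) (x, y) =
    dir_deriv (0, \<Gamma> x u w) L (x, y) + dir_deriv (0, w) (dir_deriv (0, \<Gamma> x u y) L) (x, y)"
proof (rule vector_derivative_unique_at)
  let ?z = "(x, y)"
  have z: "?z \<in> slit" using assms by auto
  show "((\<lambda>t. dir_deriv (u, 0) L (?z + t *\<^sub>R (0, w))) has_vector_derivative
      dir_deriv (0, w) (dir_deriv (u, 0) L) ?z) (at 0)"
    using dir_deriv_line[OF smooth_on_dir_deriv[OF smooth_L], of ?z 0 "(0, w)" "(u, 0)"] z by simp
  show "((\<lambda>t. dir_deriv (u, 0) L (?z + t *\<^sub>R (0, w))) has_vector_derivative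
      dir_deriv (0, \<Gamma> x u w) L ?z + dir_deriv (0, w) (dir_deriv (0, \<Gamma> x u y) L) ?z) (at 0)"
  proof (rule has_vector_derivative_transform_within_open
      [OF dir_deriv_line_moving[OF open_slit smooth_L z] open_line_nonzero[OF assms(2), of w]])
    fix t assume "t \<in> {t. y + t *\<^sub>R w \<noteq> 0}"
    then show "dir_deriv ((0, \<Gamma> x u y) + t *\<^sub>R (0, \<Gamma> x u w)) L (?z + t *\<^sub>R (0, w))
        = dir_deriv (u, 0) L (?z + t *\<^sub>R (0, w))"
      using horizontal[OF assms(1), of "y + t *\<^sub>R w" u] bilinear_\<Gamma>[OF assms(1)]
      by (simp add: bilinear_radd bilinear_rmul)
  qed
qed

lemma horizontal1:
  assumes "x \<in> S" "y \<noteq> 0"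
  shows "dir_deriv (u, 0) (dir_deriv (0, w) L) (x, y) =
    dir_deriv (0, \<Gamma> x u w) L (x, y) + dir_deriv (0, \<Gamma> x u y) (dir_deriv (0, w) L) (x, y)"
  using horizontal_vertical[OF assms, of w u] assms
  by (simp add: dir_deriv_commute[OF open_slit smooth_L, of "(x, y)" "(0, w)"])

text \<open>A second vertical derivative, now of \<open>horizontal1\<close>. The outcome says that
  \<open>H\<close>, as a tensor on the fibres, is parallel along the horizontal direction (u,
  -\<open>\<Gamma> x u y\<close>).\<close>

lemma horizontal2:
  assumes "x \<in> S" "y \<noteq> 0"
  shows "dir_deriv (u, 0) (\<lambda>z. H z a b) (x, y) =
    H (x, y) a (\<Gamma> x u b) + H (x, y) (\<Gamma> x u a) b + T (x, y) (\<Gamma> x u y) a b"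
proof -
  let ?z = "(x, y)"
  let ?f = "dir_deriv (0, b) L"
  have z: "?z \<in> slit" using assms by auto
  have f: "smooth_on slit ?f" by (rule smooth_on_dir_deriv[OF smooth_L])
  have 1: "((\<lambda>t. dir_deriv (0, \<Gamma> x u b) L (?z + t *\<^sub>R (0, a))) has_vector_derivative
      dir_deriv (0, a) (dir_deriv (0, \<Gamma> x u b) L) ?z) (at 0)"
    using dir_deriv_line[OF smooth_on_dir_deriv[OF smooth_L], of ?z 0 "(0, a)"] z by simp
  have "dir_deriv (0, a) (dir_deriv (u, 0) ?f) ?z =
    dir_deriv (0, a) (dir_deriv (0, \<Gamma> x u b) L) ?z +
    (dir_deriv (0, \<Gamma> x u a) ?f ?z + dir_deriv (0, a) (dir_deriv (0, \<Gamma> x u y) ?f) ?z)"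
  proof (rule vector_derivative_unique_at)
    show "((\<lambda>t. dir_deriv (u, 0) ?f (?z + t *\<^sub>R (0, a))) has_vector_derivative
        dir_deriv (0, a) (dir_deriv (u, 0) ?f) ?z) (at 0)"
      using dir_deriv_line[OF smooth_on_dir_deriv[OF f], of ?z 0 "(0, a)" "(u, 0)"] z by simp
    show "((\<lambda>t. dir_deriv (u, 0) ?f (?z + t *\<^sub>R (0, a))) has_vector_derivative
        dir_deriv (0, a) (dir_deriv (0, \<Gamma> x u b) L) ?z +
        (dir_deriv (0, \<Gamma> x u a) ?f ?z + dir_deriv (0, a) (dir_deriv (0, \<Gamma> x u y) ?f) ?z)) (at 0)"
    proof (rule has_vector_derivative_transform_within_open
        [OF has_vector_derivative_add[OF 1 dir_deriv_line_moving[OF open_slit f z]]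
            open_line_nonzero[OF assms(2), of a]])
      fix t assume "t \<in> {t. y + t *\<^sub>R a \<noteq> 0}"
      then show "dir_deriv (0, \<Gamma> x u b) L (?z + t *\<^sub>R (0, a)) +
          dir_deriv ((0, \<Gamma> x u y) + t *\<^sub>R (0, \<Gamma> x u a)) ?f (?z + t *\<^sub>R (0, a))
          = dir_deriv (u, 0) ?f (?z + t *\<^sub>R (0, a))"
        using horizontal1[OF assms(1), of "y + t *\<^sub>R a" u b] bilinear_\<Gamma>[OF assms(1)]
        by (simp add: bilinear_radd bilinear_rmul)
    qed
  qed
  then show ?thesis
    using z dir_deriv_commute[OF open_slit f, of ?z "(0, a)"]
    by (simp add: H_def T_def)
qed

text \<open>The chain rule for y |-> l y: a vertical derivative lowers the degree of homogeneity by
  one. It is used with c = l^2 for \<open>L\<close> and with c = l for its first vertical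
  derivative.\<close>

lemma vertical_scale:
  fixes g :: "'e \<times> 'e \<Rightarrow> real"
  assumes g: "smooth_on slit g"
    and scale: "\<And>x y. x \<in> S \<Longrightarrow> y \<noteq> 0 \<Longrightarrow> g (x, l *\<^sub>R y) = c * g (x, y)"
    and l: "0 < l" and xy: "x \<in> S" "y \<noteq> 0"
  shows "l * dir_deriv (0, w) g (x, l *\<^sub>R y) = c * dir_deriv (0, w) g (x, y)"
proof (rule vector_derivative_unique_at)
  have "((\<lambda>t. g ((x, l *\<^sub>R y) + t *\<^sub>R (0, l *\<^sub>R w))) has_vector_derivative
      dir_deriv (0, l *\<^sub>R w) g (x, l *\<^sub>R y)) (at 0)"
    using dir_deriv_line[OF g, of "(x, l *\<^sub>R y)" 0 "(0, l *\<^sub>R w)"] l xy by simp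
  moreover have "dir_deriv (0, l *\<^sub>R w) g (x, l *\<^sub>R y) = l * dir_deriv (0, w) g (x, l *\<^sub>R y)"
    using linear_scale[OF linear_vertical[OF g], of "(x, l *\<^sub>R y)" l w] l xy by simp
  ultimately show "((\<lambda>t. g ((x, l *\<^sub>R y) + t *\<^sub>R (0, l *\<^sub>R w))) has_vector_derivative
      l * dir_deriv (0, w) g (x, l *\<^sub>R y)) (at 0)" by simp
  have "((\<lambda>t. g ((x, y) + t *\<^sub>R (0, w))) has_vector_derivative dir_deriv (0, w) g (x, y)) (at 0)"
    using dir_deriv_line[OF g, of "(x, y)" 0 "(0, w)"] xy by simp
  then have "((\<lambda>t. c * g ((x, y) + t *\<^sub>R (0, w))) has_vector_derivative
      c * dir_deriv (0, w) g (x, y)) (at 0)"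
    by (rule has_vector_derivative_mult_right)
  then show "((\<lambda>t. g ((x, l *\<^sub>R y) + t *\<^sub>R (0, l *\<^sub>R w))) has_vector_derivative
      c * dir_deriv (0, w) g (x, y)) (at 0)"
  proof (rule has_vector_derivative_transform_within_open[OF _ open_line_nonzero[OF xy(2), of w]])
    fix t assume "t \<in> {t. y + t *\<^sub>R w \<noteq> 0}"
    then show "c * g ((x, y) + t *\<^sub>R (0, w)) = g ((x, l *\<^sub>R y) + t *\<^sub>R (0, l *\<^sub>R w))"
      using scale[OF xy(1), of "y + t *\<^sub>R w"] by (simp add: scaleR_add_right ac_simps)
  qed
qed

lemma H_scale:
  assumes "x \<in> S" "y \<noteq> 0" "0 < l"
  shows "H (x, l *\<^sub>R y) a b = H (x, y) a b"
proof -
  have "l * dir_deriv (0, b) L (x, l *\<^sub>R y) = l\<^sup>2 * dir_deriv (0, b) L (x, y)"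
    if "x \<in> S" "y \<noteq> 0" for x y
    by (rule vertical_scale[OF smooth_L L_scale[OF _ _ assms(3)] assms(3) that])
  then have "dir_deriv (0, b) L (x, l *\<^sub>R y) = l * dir_deriv (0, b) L (x, y)"
    if "x \<in> S" "y \<noteq> 0" for x y
    using that assms(3) by (simp add: power2_eq_square)
  from vertical_scale[OF smooth_on_dir_deriv[OF smooth_L] this assms(3,1,2)]
  show ?thesis using assms(3) by (simp add: H_def)
qed

text \<open>Euler's relation in degree 0: by \<open>H_scale\<close>, \<open>H\<close> is constant
  along (x, (1 + t) y) while 1 + t > 0, and the left side is its derivative at t = 0.\<close>

lemma T_radial:
  assumes "x \<in> S" "y \<noteq> 0"
  shows "T (x, y) y a b = 0"
proof (rule vector_derivative_unique_at)
  show "((\<lambda>t. H ((x, y) + t *\<^sub>R (0, y)) a b) has_vector_derivative T (x, y) y a b) (at 0)"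
    using dir_deriv_line[OF smooth_H, of "(x, y)" 0 "(0, y)"] assms by (simp add: T_def)
  have "((\<lambda>t. H (x, y) a b) has_vector_derivative 0) (at (0::real))"
    by (rule has_vector_derivative_const)
  then show "((\<lambda>t. H ((x, y) + t *\<^sub>R (0, y)) a b) has_vector_derivative 0) (at 0)"
  proof (rule has_vector_derivative_transform_within_open[where S="{-1<..}"])
    fix t :: real assume "t \<in> {-1<..}"
    then have "0 < 1 + t" by simp
    from H_scale[OF assms this, of a b]
    show "H (x, y) a b = H ((x, y) + t *\<^sub>R (0, y)) a b" by (simp add: scaleR_add_left)
  qed auto
qed

end

text \<open>Differentiating \<open>\<partial>\<^sub>y L (\<Delta>(u, y)) = 0\<close> in \<open>y\<close>, where \<open>\<Delta>\<close> is the difference of two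
  connections, and putting \<open>u = y\<close> leaves only the Hessian term.\<close>

lemma berwald_chart_unique:
  assumes "berwald_chart S L \<Gamma>" "berwald_chart S L \<Gamma>'" "x \<in> S"
  shows "\<Gamma> x u w = \<Gamma>' x u w"
proof -
  interpret a: berwald_chart S L \<Gamma> by fact
  interpret b: berwald_chart S L \<Gamma>' by fact
  let ?D = "\<lambda>u w. \<Gamma> x u w - \<Gamma>' x u w"
  have diag: "?D y y = 0" if "y \<noteq> 0" for y
  proof (rule a.H_nondegenerate)
    let ?z = "(x, y)"
    show z: "?z \<in> a.slit" using assms(3) that by auto
    fix w
    note lin = a.linear_vertical[OF a.smooth_L z]
    have "dir_deriv (0, \<Gamma> x w y) L ?z = dir_deriv (0, \<Gamma>' x w y) L ?z"
      using a.horizontal[OF assms(3) that, of w] b.horizontal[OF assms(3) that, of w] by simp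
    \<comment> \<open>Torsion-freeness swaps the arguments, so that these become the first-order
      terms of \<open>horizontal_vertical\<close> for direction \<open>y\<close> and cancel between
      the two connections.\<close>
    then have "dir_deriv (0, \<Gamma> x y w) L ?z = dir_deriv (0, \<Gamma>' x y w) L ?z"
      using a.\<Gamma>_commute[OF assms(3), of w y] b.\<Gamma>_commute[OF assms(3), of w y] by simp
    then have "a.H ?z w (\<Gamma> x y y) = a.H ?z w (\<Gamma>' x y y)"
      using a.horizontal_vertical[OF assms(3) that, of w y]
        b.horizontal_vertical[OF assms(3) that, of w y] by (simp add: a.H_def)
    then show "a.H ?z (?D y y) w = a.H ?z 0 w"
      using a.bilinear_H[OF z] by (simp add: a.H_commute[OF z, of _ w] bilinear_rsub bilinear_rzero)
  qed
  have bil: "bilinear (\<Gamma> x)" "bilinear (\<Gamma>' x)"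
    using a.bilinear_\<Gamma> b.bilinear_\<Gamma> assms(3) by auto
  have diag': "?D y y = 0" for y
    using diag[of y] bil by (cases "y = 0") (simp_all add: bilinear_lzero)
  \<comment> \<open>Polarization: the difference is symmetric and bilinear, hence determined by its
    diagonal.\<close>
  have "?D (u + w) (u + w) = ?D u u + ?D w w + 2 *\<^sub>R ?D u w"
    using bil a.\<Gamma>_commute[OF assms(3), of w u] b.\<Gamma>_commute[OF assms(3), of w u]
    by (simp add: bilinear_ladd bilinear_radd scaleR_2)
  then show ?thesis using diag' by simp
qed

section \<open>The Riemannian metric defined by a geodesic field\<close>

locale berwald_field = berwald_chart S L \<Gamma>
  for S :: "'e::euclidean_space set" and L \<Gamma> +
  fixes V :: "'e \<Rightarrow> 'e"
  assumes smooth_V: "smooth_on S V" and V_nonzero: "\<And>z. z \<in> S \<Longrightarrow> V z \<noteq> 0"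
    and V_geodesic: "\<And>z. z \<in> S \<Longrightarrow> dir_deriv (V z) V z + \<Gamma> z (V z) (V z) = 0"
begin

text \<open>The covariant derivative of \<open>V\<close> in direction \<open>u\<close>.\<close>

definition N :: "'e \<Rightarrow> 'e \<Rightarrow> 'e" where
  "N z u = dir_deriv u V z + \<Gamma> z u (V z)"

definition g :: "'e \<Rightarrow> 'e \<Rightarrow> 'e \<Rightarrow> real" where
  "g z a b = H (z, V z) a b"

text \<open>The right side of the Koszul formula for constant coordinate fields, in the shape in
  which \<open>levi_civita\<close> uses it.\<close>

abbreviation koszul :: "'e \<Rightarrow> 'e \<Rightarrow> 'e \<Rightarrow> 'e \<Rightarrow> real" where
  "koszul z u w y \<equiv> dir_deriv u (\<lambda>z. g z w y) z + dir_deriv w (\<lambda>z. g z u y) z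
     - dir_deriv y (\<lambda>z. g z u w) z"

lemma slit_V: "z \<in> S \<Longrightarrow> (z, V z) \<in> slit"
  using V_nonzero by auto

lemma linear_N: "z \<in> S \<Longrightarrow> linear (N z)"
  unfolding N_def using linear_dir_deriv[OF smooth_V, of z] bilinear_\<Gamma>[of z]
  by (intro linear_compose_add) (auto simp: bilinear_def)

lemma N_V: "z \<in> S \<Longrightarrow> N z (V z) = 0"
  using V_geodesic by (simp add: N_def)

lemma smooth_g: "smooth_on S (\<lambda>z. g z a b)"
  unfolding g_def
  by (rule smooth_on_comp[OF open_S open_slit slit_V smooth_H])
     (auto intro!: smooth_on_Pair smooth_on_ident open_S smooth_V)

text \<open>By the chain rule through z |-> (z, V z), the term \<open>\<Gamma> z u (V z)\<close>
  from \<open>horizontal2\<close> and the derivative of \<open>V\<close> enter \<open>T\<close> in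
  the same slot and add up to \<open>N z u\<close>.\<close>

lemma g_deriv:
  assumes "z \<in> S"
  shows "dir_deriv u (\<lambda>z. g z a b) z =
    g z a (\<Gamma> z u b) + g z (\<Gamma> z u a) b + T (z, V z) (N z u) a b"
proof -
  have z: "(z, V z) \<in> slit" using assms by (rule slit_V)
  have "((\<lambda>z. (z, V z)) has_derivative (\<lambda>u. (u, dir_deriv u V z))) (at z)"
    by (intro derivative_intros smooth_on_has_dir_deriv[OF smooth_V assms])
  from dir_deriv_eq[OF has_derivative_compose[OF this smooth_on_has_dir_deriv[OF smooth_H z]]]
  have "dir_deriv u (\<lambda>z. g z a b) z = dir_deriv (u, dir_deriv u V z) (\<lambda>z. H z a b) (z, V z)"
    by (simp add: g_def)
  also have "\<dots> = dir_deriv (u, 0) (\<lambda>z. H z a b) (z, V z) + T (z, V z) (dir_deriv u V z) a b"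
    using linear_add[OF linear_dir_deriv[OF smooth_H z], of "(u, 0)" "(0, dir_deriv u V z)"]
    by (simp add: T_def)
  also have "\<dots> = g z a (\<Gamma> z u b) + g z (\<Gamma> z u a) b + T (z, V z) (N z u) a b"
    using horizontal2[OF assms V_nonzero[OF assms], of u a b] linear_add[OF linear_T1[OF z]]
    by (simp add: g_def N_def)
  finally show ?thesis .
qed

text \<open>Of the six connection terms supplied by \<open>g_deriv\<close>, four cancel in pairs by
  the symmetry of \<open>\<Gamma>\<close> and of \<open>H\<close>; the other two are equal.\<close>

lemma koszul_eq:
  assumes "z \<in> S"
  shows "koszul z u w y = 2 * g z (\<Gamma> z u w) y
    + (T (z, V z) (N z u) w y + T (z, V z) (N z w) u y - T (z, V z) (N z y) u w)"
proof -
  note z = slit_V[OF assms]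
  show ?thesis
    unfolding g_deriv[OF assms]
    using \<Gamma>_commute[OF assms, of w u] \<Gamma>_commute[OF assms, of y u] \<Gamma>_commute[OF assms, of y w]
      H_commute[OF z, of "\<Gamma> z u y" w] H_commute[OF z, of "\<Gamma> z w y" u]
    by (simp add: g_def)
qed

lemma linear_koszul:
  assumes "z \<in> S" shows "linear (koszul z u w)"
proof -
  note z = slit_V[OF assms]
  have "linear (g z a)" for a using bilinear_H[OF z] by (simp add: g_def[abs_def] bilinear_def)
  moreover have "linear (\<lambda>y. T (z, V z) (N z y) u w)"
    using linear_compose[OF linear_N[OF assms] linear_T1[OF z]] by (simp add: o_def)
  ultimately show ?thesis
    unfolding koszul_eq[OF assms]
    by (intro linear_compose_add linear_compose_sub linear_T3[OF z]) (auto simp: linear_iff algebra_simps)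
qed

lemma g_form:
  assumes "z \<in> S"
  shows "bilinear (g z)" "v \<noteq> 0 \<Longrightarrow> 0 < g z v v"
  using bilinear_H[OF slit_V[OF assms]] H_pos[OF slit_V[OF assms]] by (simp_all add: g_def[abs_def])

text \<open>Makes the definite description in \<open>levi_civita\<close> meaningful: the Gram
  operator is onto, and linearity of \<open>koszul\<close> in \<open>y\<close> reduces the equation
  to basis vectors.\<close>

lemma levi_civita_ex1:
  assumes "z \<in> S"
  shows "\<exists>!q. \<forall>y. 2 * g z q y = koszul z u w y"
proof -
  let ?A = "\<lambda>v. \<Sum>b\<in>Basis. g z v b *\<^sub>R b"
  have A: "linear ?A" "inj ?A" using pos_def_representation[of "g z"] g_form[OF assms] by blast+
  then have "surj ?A" by (rule linear_inj_imp_surj)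
  from surjD[OF this] obtain q where q: "(\<Sum>b\<in>Basis. (koszul z u w b / 2) *\<^sub>R b) = ?A q" by (rule exE)
  have q': "g z q b = koszul z u w b / 2" if "b \<in> Basis" for b
    using arg_cong[OF q[symmetric], of "\<lambda>a. a \<bullet> b"] that
    by (simp add: inner_sum_left inner_Basis if_distrib sum.delta cong: if_cong)
  have "2 * g z q y = koszul z u w y" for y
    using linear_basis_expansion[OF linear_koszul[OF assms, of u w], of y]
      linear_basis_expansion[of "g z q" y] g_form(1)[OF assms]
    by (simp add: bilinear_def q' sum_distrib_left cong: sum.cong)
  moreover have "q' = q" if "\<forall>y. 2 * g z q' y = 2 * g z q y" for q'
    by (rule H_nondegenerate[OF slit_V[OF assms]]) (use that in \<open>simp add: g_def\<close>)
  ultimately show ?thesis by metis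
qed

end

text \<open>\<open>C\<close> is given only by its pointwise equation; the linearity and continuity
  required below are derived from it.\<close>

locale berwald_levi_civita = berwald_field S L \<Gamma> V
  for S :: "'e::euclidean_space set" and L \<Gamma> V +
  fixes C :: "'e \<Rightarrow> 'e \<Rightarrow> 'e \<Rightarrow> 'e"
  assumes C: "\<And>z u w y. z \<in> S \<Longrightarrow> 2 * g z (C z u w) y = koszul z u w y"
begin

definition D :: "'e \<Rightarrow> 'e \<Rightarrow> 'e \<Rightarrow> 'e" where
  "D z u w = C z u w - \<Gamma> z u w"

lemma D_eq:
  assumes "z \<in> S"
  shows "2 * g z (D z u w) y
    = T (z, V z) (N z u) w y + T (z, V z) (N z w) u y - T (z, V z) (N z y) u w"
  using C[OF assms, of u w y] koszul_eq[OF assms, of u w y]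
  by (simp add: D_def bilinear_lsub[OF g_form(1)[OF assms]] algebra_simps)

text \<open>Since \<open>g\<close> is nondegenerate, algebraic properties of \<open>D\<close> can be
  read off the right side, which involves only \<open>T\<close> and \<open>N\<close>.\<close>

lemma D_eqI:
  assumes "z \<in> S" "\<And>y. 2 * g z q y
    = T (z, V z) (N z u) w y + T (z, V z) (N z w) u y - T (z, V z) (N z y) u w"
  shows "D z u w = q"
proof (rule H_nondegenerate[OF slit_V[OF assms(1)]])
  show "H (z, V z) (D z u w) y = H (z, V z) q y" for y
    using assms(2)[of y] D_eq[OF assms(1), of u w y] by (simp add: g_def)
qed

lemma D_commute: "z \<in> S \<Longrightarrow> D z u w = D z w u"
  by (rule D_eqI) (simp_all add: D_eq T_commute23[OF slit_V, of z "N z y" w u for y])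

lemma linear_D: assumes "z \<in> S" shows "linear (D z u)"
proof -
  note z = slit_V[OF assms]
  let ?R = "\<lambda>w y. T (z, V z) (N z u) w y + T (z, V z) (N z w) u y - T (z, V z) (N z y) u w"
  have R: "linear (\<lambda>w. ?R w y)" for y
    using linear_compose[OF linear_N[OF assms] linear_T1[OF z]]
    by (intro linear_compose_add linear_compose_sub linear_T2[OF z] linear_T3[OF z]) (simp add: o_def)
  show ?thesis
  proof (rule linearI)
    show "D z u (a + b) = D z u a + D z u b" for a b
    proof (rule D_eqI[OF assms])
      show "2 * g z (D z u a + D z u b) y = ?R (a + b) y" for y
        using linear_add[OF R, of a b y]
        by (simp only: bilinear_ladd[OF g_form(1)[OF assms]] distrib_left D_eq[OF assms])
    qed
    show "D z u (r *\<^sub>R a) = r *\<^sub>R D z u a" for r a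
    proof (rule D_eqI[OF assms])
      show "2 * g z (r *\<^sub>R D z u a) y = ?R (r *\<^sub>R a) y" for y
        using linear_scale[OF R, of r a y] D_eq[OF assms, of u a y]
        by (simp add: bilinear_lmul[OF g_form(1)[OF assms]])
    qed
  qed
qed

text \<open>The derivative of \<open>g\<close> with respect to \<open>\<Gamma>\<close> is \<open>T\<close>, which is killed by \<open>V\<close>, evaluated
  on \<open>N\<close>, and \<open>N V = 0\<close>. So the two connections give the same derivatives of \<open>V\<close>, and along \<open>V\<close>.\<close>

lemma D_V: assumes "z \<in> S" shows "D z u (V z) = 0"
proof (rule D_eqI[OF assms])
  fix y
  note z = slit_V[OF assms]
  have radial: "T (z, V z) (V z) a b = 0" for a b
    by (rule T_radial[OF assms V_nonzero[OF assms]])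
  have "T (z, V z) (N z u) (V z) y = 0"
    using radial[of "N z u" y] by (simp add: T_commute12[OF z])
  moreover have "T (z, V z) (N z (V z)) u y = 0"
    using linear_0[OF linear_T1[OF z]] by (simp add: N_V[OF assms])
  moreover have "T (z, V z) (N z y) u (V z) = 0"
    using radial[of "N z y" u] by (simp add: T_commute12[OF z, of "N z y"] T_commute23[OF z, of _ u])
  ultimately show "2 * g z 0 y = T (z, V z) (N z u) (V z) y + T (z, V z) (N z (V z)) u y
      - T (z, V z) (N z y) u (V z)"
    by (simp add: bilinear_lzero[OF g_form(1)[OF assms]])
qed

text \<open>\<open>C z u w\<close> solves a linear system whose matrix, the Gram matrix of
  \<open>g z\<close>, and right side, half of \<open>koszul\<close>, are continuous in
  \<open>z\<close>.\<close>

lemma isCont_C: assumes x: "x \<in> S" shows "isCont (\<lambda>z. C z u w) x"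
proof -
  let ?A = "\<lambda>z v. \<Sum>b\<in>Basis. g z v b *\<^sub>R b"
  have S: "\<forall>\<^sub>F z in at x. z \<in> S" using open_S x by (rule eventually_at_in_open')
  have lim: "(h \<longlongrightarrow> h x) (at x)" if "smooth_on S h" for h :: "'e \<Rightarrow> real"
    using smooth_on_continuous[OF that] open_S x by (simp add: continuous_on_eq_continuous_at isCont_def)
  have g: "((\<lambda>z. g z a b) \<longlongrightarrow> g x a b) (at x)" for a b
    by (rule lim[OF smooth_g])
  have k: "((\<lambda>z. koszul z u w b) \<longlongrightarrow> koszul x u w b) (at x)" for b
    by (intro tendsto_intros lim smooth_on_dir_deriv smooth_g)
  have A: "linear (?A z)" "inj (?A z)" if "z \<in> S" for z
    using pos_def_representation[of "g z"] g_form[OF that] by blast+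
  have sol: "?A z (C z u w) = (\<Sum>b\<in>Basis. (koszul z u w b / 2) *\<^sub>R b)" if "z \<in> S" for z
    using C[OF that, of u w] by (intro sum.cong refl arg_cong2[where f=scaleR]) (simp add: field_simps)
  show ?thesis
    unfolding isCont_def
  proof (rule tendsto_linear_solution)
    show "\<forall>\<^sub>F z in at x. linear (?A z)" using S by eventually_elim (rule A)
    show "((\<lambda>z. ?A z b) \<longlongrightarrow> ?A x b) (at x)" for b by (intro tendsto_intros g)
    show "linear (?A x)" "inj (?A x)" using A x by auto
    show "\<forall>\<^sub>F z in at x. ?A z (C z u w) = (\<Sum>b\<in>Basis. (koszul z u w b / 2) *\<^sub>R b)"
      using S by eventually_elim (rule sol)
    show "((\<lambda>z. \<Sum>b\<in>Basis. (koszul z u w b / 2) *\<^sub>R b) \<longlongrightarrow> ?A x (C x u w)) (at x)"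
      unfolding sol[OF x] by (intro tendsto_intros k) simp
  qed
qed

lemma isCont_D: assumes "x \<in> S" shows "isCont (\<lambda>z. D z u w) x"
  unfolding D_def
  using smooth_on_continuous[OF smooth_\<Gamma>] open_S assms
  by (intro continuous_intros isCont_C) (auto simp: continuous_on_eq_continuous_at)

text \<open>Near \<open>x\<close> we have \<open>D z u (V x) = D z u (V x - V z)\<close>, so that continuity of \<open>D\<close> suffices.\<close>

lemma dir_deriv_C:
  assumes x: "x \<in> S"
  shows "dir_deriv h (\<lambda>z. C z u (V x)) x = dir_deriv h (\<lambda>z. \<Gamma> z u (V x)) x - D x u (dir_deriv h V x)"
proof -
  let ?v = "V x"
  have V': "((\<lambda>z. (?v - V z) \<bullet> b) has_derivative (\<lambda>h. (0 - dir_deriv h V x) \<bullet> b)) (at x)" for b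
    by (intro derivative_intros smooth_on_has_dir_deriv[OF smooth_V x])
  have "((\<lambda>z. \<Gamma> z u ?v + (\<Sum>b\<in>Basis. ((?v - V z) \<bullet> b) *\<^sub>R D z u b)) has_derivative
    (\<lambda>h. dir_deriv h (\<lambda>z. \<Gamma> z u ?v) x + (\<Sum>b\<in>Basis. ((0 - dir_deriv h V x) \<bullet> b) *\<^sub>R D x u b))) (at x)"
    by (intro has_derivative_add has_derivative_sum smooth_on_has_dir_deriv[OF smooth_\<Gamma> x]
        has_derivative_scaleR_zero V' isCont_D[OF x]) simp
  then have "((\<lambda>z. C z u ?v) has_derivative
    (\<lambda>h. dir_deriv h (\<lambda>z. \<Gamma> z u ?v) x + (\<Sum>b\<in>Basis. ((0 - dir_deriv h V x) \<bullet> b) *\<^sub>R D x u b))) (at x)"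
  proof (rule has_derivative_transform_within_open[OF _ open_S x])
    fix z assume z: "z \<in> S"
    have "(\<Sum>b\<in>Basis. ((?v - V z) \<bullet> b) *\<^sub>R D z u b) = D z u ?v"
      using linear_basis_expansion[OF linear_D[OF z], of u "?v - V z"] linear_diff[OF linear_D[OF z], of u ?v "V z"]
        D_V[OF z] by simp
    then show "\<Gamma> z u ?v + (\<Sum>b\<in>Basis. ((?v - V z) \<bullet> b) *\<^sub>R D z u b) = C z u ?v"
      by (simp add: D_def)
  qed
  from dir_deriv_eq[OF this, of h]
  have "dir_deriv h (\<lambda>z. C z u ?v) x = dir_deriv h (\<lambda>z. \<Gamma> z u ?v) x + D x u (0 - dir_deriv h V x)"
    using linear_basis_expansion[OF linear_D[OF x], of u "0 - dir_deriv h V x"] by simp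
  then show ?thesis using linear_diff[OF linear_D[OF x], of u 0 "dir_deriv h V x"] linear_0[OF linear_D[OF x], of u] by simp
qed

text \<open>\<open>C\<close> and \<open>\<Gamma>\<close> agree as soon as one argument is
  \<open>v\<close>. The two sides then differ by \<open>D x u (dir_deriv v V x)\<close>, which comes
  from \<open>dir_deriv_C\<close>, plus \<open>D x u (\<Gamma> x v v)\<close>; the sum is
  \<open>D x u\<close> of the covariant derivative of \<open>V\<close> along itself, which is
  0.\<close>

theorem curvature_V:
  assumes x: "x \<in> S" and v: "v = V x"
  shows "dir_deriv u (\<lambda>z. C z v v) x - dir_deriv v (\<lambda>z. C z u v) x + C x u (C x v v) - C x v (C x u v)
    = dir_deriv u (\<lambda>z. \<Gamma> z v v) x - dir_deriv v (\<lambda>z. \<Gamma> z u v) x + \<Gamma> x u (\<Gamma> x v v) - \<Gamma> x v (\<Gamma> x u v)"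
proof -
  have Cv: "C x q v = \<Gamma> x q v" for q using D_V[OF x, of q] by (simp add: D_def v)
  have Dv: "D x v q = 0" for q using D_commute[OF x, of v q] D_V[OF x, of q] by (simp add: v)
  then have vC: "C x v q = \<Gamma> x v q" for q by (simp add: D_def)
  have "D x u (dir_deriv v V x + \<Gamma> x v v) = 0"
    using V_geodesic[OF x] linear_0[OF linear_D[OF x], of u] by (simp add: v)
  then have "D x u (dir_deriv v V x) + (C x u (\<Gamma> x v v) - \<Gamma> x u (\<Gamma> x v v)) = 0"
    using linear_add[OF linear_D[OF x], of u "dir_deriv v V x" "\<Gamma> x v v"] by (simp add: D_def)
  then have "D x u (dir_deriv v V x) = \<Gamma> x u (\<Gamma> x v v) - C x u (\<Gamma> x v v)"
    by (simp add: eq_neg_iff_add_eq_0[symmetric])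
  then show ?thesis
    using dir_deriv_C[OF x, of u v] dir_deriv_C[OF x, of v u]
    by (simp add: v[symmetric] vC Cv Dv)
qed

end

section \<open>Berwald structures on a manifold\<close>

text \<open>A geodesic field lives on an open set that need not contain the chart domain, so the
  chart has to be shrunk.\<close>

lemma berwald_chart_subset:
  assumes "berwald_chart S L \<Gamma>" "open S'" "S' \<subseteq> S"
  shows "berwald_chart S' L \<Gamma>"
proof -
  interpret berwald_chart S L \<Gamma> by fact
  show ?thesis
    using assms(2,3) L_scale L_pos bilinear_\<Gamma> \<Gamma>_commute L_parallel
    by unfold_locales
       (auto intro: smooth_on_subset[OF smooth_L] smooth_on_subset[OF smooth_\<Gamma>])
qed

locale smooth_atlas =
  fixes A :: "('m::{t2_space,second_countable_topology}, 'e::euclidean_space) chart set"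
  assumes manifold: "smooth_manifold A"
begin

section \<open>Tangent vectors and their components in charts\<close>

lemma chart:
  assumes "\<phi> \<in> A"
  shows "open (dom_chart \<phi>)" "open (coord \<phi> ` dom_chart \<phi>)"
    "homeomorphism (dom_chart \<phi>) (coord \<phi> ` dom_chart \<phi>) (coord \<phi>) (inv_coord \<phi>)"
  using manifold assms unfolding smooth_manifold_def is_chart_def by auto

lemma inv_coord_coord [simp]: "\<phi> \<in> A \<Longrightarrow> p \<in> dom_chart \<phi> \<Longrightarrow> inv_coord \<phi> (coord \<phi> p) = p"
  using chart(3) by (meson homeomorphism_apply1)

lemma coord_inv_coord [simp]: "\<phi> \<in> A \<Longrightarrow> x \<in> coord \<phi> ` dom_chart \<phi> \<Longrightarrow> coord \<phi> (inv_coord \<phi> x) = x"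
  by auto

lemma transition_coord [simp]:
  "\<phi> \<in> A \<Longrightarrow> p \<in> dom_chart \<phi> \<Longrightarrow> transition \<phi> \<psi> (coord \<phi> p) = coord \<psi> p"
  by (simp add: transition_def)

lemma open_coord_image: assumes "\<phi> \<in> A" "open U" shows "open (coord \<phi> ` (U \<inter> dom_chart \<phi>))"
proof -
  have "openin (top_of_set (dom_chart \<phi>)) (U \<inter> dom_chart \<phi>)"
    using assms by (metis inf.commute openin_open_Int)
  from homeomorphism_imp_open_map[OF chart(3)[OF assms(1)] this] show ?thesis
    using chart(2)[OF assms(1)] openin_open_trans by blast
qed

lemma open_overlap: "\<phi> \<in> A \<Longrightarrow> \<psi> \<in> A \<Longrightarrow> open (coord \<phi> ` (dom_chart \<phi> \<inter> dom_chart \<psi>))"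
  using open_coord_image[of \<phi> "dom_chart \<psi>"] chart(1)[of \<psi>] by (simp add: inf.commute)

lemma smooth_transition:
  "\<phi> \<in> A \<Longrightarrow> \<psi> \<in> A \<Longrightarrow> smooth_on (coord \<phi> ` (dom_chart \<phi> \<inter> dom_chart \<psi>)) (transition \<phi> \<psi>)"
  using manifold unfolding smooth_manifold_def by blast

lemma transition_has_derivative:
  assumes "\<phi> \<in> A" "\<psi> \<in> A" "p \<in> dom_chart \<phi>" "p \<in> dom_chart \<psi>"
  shows "(transition \<phi> \<psi> has_derivative frechet_derivative (transition \<phi> \<psi>) (at (coord \<phi> p))) (at (coord \<phi> p))"
  by (rule smooth_on_has_derivative[OF smooth_transition]) (use assms in auto)

lemma transition_chain:
  assumes "\<phi> \<in> A" "\<psi> \<in> A" "\<theta> \<in> A" "p \<in> dom_chart \<phi>" "p \<in> dom_chart \<psi>" "p \<in> dom_chart \<theta>"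
  shows "frechet_derivative (transition \<phi> \<theta>) (at (coord \<phi> p)) y =
    frechet_derivative (transition \<psi> \<theta>) (at (coord \<psi> p)) (frechet_derivative (transition \<phi> \<psi>) (at (coord \<phi> p)) y)"
proof -
  let ?x = "coord \<phi> p" and ?O = "coord \<phi> ` ((dom_chart \<psi> \<inter> dom_chart \<theta>) \<inter> dom_chart \<phi>)"
  have d: "(transition \<psi> \<theta> has_derivative frechet_derivative (transition \<psi> \<theta>) (at (coord \<psi> p)))
      (at (transition \<phi> \<psi> ?x))"
    using transition_has_derivative[of \<psi> \<theta> p] assms by simp
  have "((\<lambda>x. transition \<psi> \<theta> (transition \<phi> \<psi> x)) has_derivative
    (\<lambda>y. frechet_derivative (transition \<psi> \<theta>) (at (coord \<psi> p)) (frechet_derivative (transition \<phi> \<psi>) (at ?x) y))) (at ?x)"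
    by (rule has_derivative_compose[OF transition_has_derivative[OF assms(1,2,4,5)] d])
  then have "(transition \<phi> \<theta> has_derivative
    (\<lambda>y. frechet_derivative (transition \<psi> \<theta>) (at (coord \<psi> p)) (frechet_derivative (transition \<phi> \<psi>) (at ?x) y))) (at ?x)"
  proof (rule has_derivative_transform_within_open[where s="?O"])
    show "open ?O" using assms chart(1) by (intro open_coord_image open_Int) auto
    show "?x \<in> ?O" using assms by auto
    show "transition \<psi> \<theta> (transition \<phi> \<psi> x) = transition \<phi> \<theta> x" if "x \<in> ?O" for x
      using that assms by auto
  qed
  from frechet_derivative_at[OF this] show ?thesis by metis
qed

lemma transition_self:
  assumes "\<phi> \<in> A" "p \<in> dom_chart \<phi>"
  shows "frechet_derivative (transition \<phi> \<phi>) (at (coord \<phi> p)) y = y"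
proof -
  have "((\<lambda>x. x) has_derivative (\<lambda>y. y)) (at (coord \<phi> p))" by (rule has_derivative_ident)
  then have "(transition \<phi> \<phi> has_derivative (\<lambda>y. y)) (at (coord \<phi> p))"
    by (rule has_derivative_transform_within_open[OF _ chart(2)[OF assms(1)]]) (use assms in auto)
  from frechet_derivative_at[OF this] show ?thesis by metis
qed

lemma tvec_of_self [simp]: "\<phi> \<in> A \<Longrightarrow> p \<in> dom_chart \<phi> \<Longrightarrow> tvec_of A \<phi> p y \<phi> = y"
  by (simp add: tvec_of_def transition_self)

lemma tvec_of_tangent: "\<phi> \<in> A \<Longrightarrow> p \<in> dom_chart \<phi> \<Longrightarrow> tvec_of A \<phi> p y \<in> tangent_space A p"
  unfolding tangent_space_def
proof (intro CollectI conjI allI ballI impI)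
  fix \<psi> \<theta> assume *: "\<phi> \<in> A" "p \<in> dom_chart \<phi>" "\<psi> \<in> A" "\<theta> \<in> A" "p \<in> dom_chart \<psi> \<inter> dom_chart \<theta>"
  show "tvec_of A \<phi> p y \<theta> = frechet_derivative (transition \<psi> \<theta>) (at (coord \<psi> p)) (tvec_of A \<phi> p y \<psi>)"
    using transition_chain[of \<phi> \<psi> \<theta> p y] * by (simp add: tvec_of_def)
qed (auto simp: tvec_of_def)

lemma tvec_of_component:
  assumes "\<phi> \<in> A" "p \<in> dom_chart \<phi>" "v \<in> tangent_space A p"
  shows "tvec_of A \<phi> p (v \<phi>) = v"
proof (rule ext)
  fix \<psi>
  show "tvec_of A \<phi> p (v \<phi>) \<psi> = v \<psi>"
  proof (cases "\<psi> \<in> A \<and> p \<in> dom_chart \<psi>")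
    case True
    then have "v \<psi> = frechet_derivative (transition \<phi> \<psi>) (at (coord \<phi> p)) (v \<phi>)"
      using assms unfolding tangent_space_def by blast
    with True show ?thesis by (simp only: tvec_of_def if_True simp_thms)
  next
    case False
    then have "v \<psi> = 0" using assms(3) unfolding tangent_space_def by blast
    with False show ?thesis by (simp only: tvec_of_def if_False simp_thms)
  qed
qed

lemma tvec_of_eq_zero:
  assumes "\<phi> \<in> A" "p \<in> dom_chart \<phi>" "v \<in> tangent_space A p"
  shows "v = zero_tvec \<longleftrightarrow> v \<phi> = 0"
proof
  assume "v \<phi> = 0"
  moreover have "tvec_of A \<phi> p 0 = zero_tvec"
    unfolding tvec_of_def
    using linear_0[OF has_derivative_linear[OF transition_has_derivative[OF assms(1) _ assms(2)]]]
    by (intro ext) auto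
  ultimately show "v = zero_tvec" using tvec_of_component[OF assms] by metis
qed simp

lemma linear_tvec_of:
  assumes "\<phi> \<in> A" "p \<in> dom_chart \<phi>"
  shows "linear (\<lambda>y. tvec_of A \<phi> p y \<psi>)"
proof (cases "\<psi> \<in> A \<and> p \<in> dom_chart \<psi>")
  case True
  then show ?thesis
    using has_derivative_linear[OF transition_has_derivative[OF assms(1) _ assms(2)]]
    by (simp add: tvec_of_def)
next
  case False
  then have "(\<lambda>y. tvec_of A \<phi> p y \<psi>) = (\<lambda>y. 0)" by (auto simp: tvec_of_def)
  then show ?thesis by (simp add: linear_zero)
qed

section \<open>Curves and parallel fields given by their coordinates in one chart\<close>

context
  fixes \<phi> :: "('m, 'e) chart" and a :: "real \<Rightarrow> 'e" and J :: "real set"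
  assumes \<phi>: "\<phi> \<in> A" and J: "open J" and a: "smooth_on J a"
    and aS: "\<And>t. t \<in> J \<Longrightarrow> a t \<in> coord \<phi> ` dom_chart \<phi>"
begin

lemma chart_curve:
  shows chart_curve_dom: "t \<in> J \<Longrightarrow> inv_coord \<phi> (a t) \<in> dom_chart \<phi>"
    and chart_curve_coord: "t \<in> J \<Longrightarrow> coord \<phi> (inv_coord \<phi> (a t)) = a t"
  using aS[of t] \<phi> by auto

lemma chart_curve_continuous: "continuous_on J (inv_coord \<phi> \<circ> a)"
  unfolding o_def
  by (rule continuous_on_compose2[OF homeomorphism_cont2[OF chart(3)[OF \<phi>]] smooth_on_continuous[OF a]])
     (use aS in auto)

lemma chart_curve_open:
  assumes "\<psi> \<in> A" shows "open {t \<in> J. inv_coord \<phi> (a t) \<in> dom_chart \<psi>}"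
proof -
  have "continuous_on J (\<lambda>t. inv_coord \<phi> (a t))" using chart_curve_continuous by (simp add: o_def)
  then have "open ((\<lambda>t. inv_coord \<phi> (a t)) -` dom_chart \<psi> \<inter> J)"
    using J chart(1)[OF assms] by (simp add: continuous_on_open_vimage)
  then show ?thesis by (simp add: vimage_def Int_def conj_commute)
qed

lemma chart_curve_overlap:
  "t \<in> J \<Longrightarrow> inv_coord \<phi> (a t) \<in> dom_chart \<psi> \<Longrightarrow> a t \<in> coord \<phi> ` (dom_chart \<phi> \<inter> dom_chart \<psi>)"
  using chart_curve[of t] by (metis IntI image_eqI)

lemma chart_curve_smooth: "smooth_curve A J (inv_coord \<phi> \<circ> a)"
  unfolding smooth_curve_def
proof (intro conjI ballI chart_curve_continuous)
  fix \<psi> assume \<psi>: "\<psi> \<in> A"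
  have "smooth_on {t \<in> J. inv_coord \<phi> (a t) \<in> dom_chart \<psi>} (\<lambda>t. transition \<phi> \<psi> (a t))"
    by (rule smooth_on_comp[OF chart_curve_open[OF \<psi>] open_overlap[OF \<phi> \<psi>] _ smooth_transition[OF \<phi> \<psi>]])
       (auto intro: chart_curve_overlap smooth_on_subset[OF a])
  then show "smooth_on {t \<in> J. (inv_coord \<phi> \<circ> a) t \<in> dom_chart \<psi>} (coord \<psi> \<circ> (inv_coord \<phi> \<circ> a))"
    by (simp add: transition_def o_def)
qed

lemma chart_curve_velocity:
  assumes t: "t \<in> J" and a': "(a has_vector_derivative a') (at t)"
  shows "velocity A (inv_coord \<phi> \<circ> a) t = tvec_of A \<phi> (inv_coord \<phi> (a t)) a'"
proof (rule ext)
  fix \<psi>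
  show "velocity A (inv_coord \<phi> \<circ> a) t \<psi> = tvec_of A \<phi> (inv_coord \<phi> (a t)) a' \<psi>"
  proof (cases "\<psi> \<in> A \<and> inv_coord \<phi> (a t) \<in> dom_chart \<psi>")
    case True
    then have "((\<lambda>s. transition \<phi> \<psi> (a s)) has_vector_derivative dir_deriv a' (transition \<phi> \<psi>) (a t)) (at t)"
      using chart_curve_overlap[OF t] by (intro dir_deriv_curve[OF smooth_transition[OF \<phi>] _ a']) auto
    from vector_derivative_at[OF this] True show ?thesis
      by (simp add: velocity_def tvec_of_def dir_deriv_def chart_curve_coord[OF t] transition_def o_def)
  qed (auto simp: velocity_def tvec_of_def)
qed

text \<open>The parallel equation in \<open>\<phi>\<close> implies that in every other chart:
  differentiating the transformed components yields a second derivative of the transition map, and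
  the transformation law of the Christoffel symbols absorbs exactly this term.\<close>

lemma chart_curve_parallel:
  assumes \<Gamma>: "affine_connection A \<Gamma>"
    and a': "\<And>t. t \<in> J \<Longrightarrow> (a has_vector_derivative a' t) (at t)"
    and Y: "\<And>t. t \<in> J \<Longrightarrow> (Y has_vector_derivative - \<Gamma> \<phi> (a t) (a' t) (Y t)) (at t)"
  shows "parallel_along A \<Gamma> J (inv_coord \<phi> \<circ> a) (\<lambda>t. tvec_of A \<phi> (inv_coord \<phi> (a t)) (Y t))"
  unfolding parallel_along_def
proof (intro conjI ballI impI)
  show "tvec_of A \<phi> (inv_coord \<phi> (a t)) (Y t) \<in> tangent_space A ((inv_coord \<phi> \<circ> a) t)" if "t \<in> J" for t
    using tvec_of_tangent[OF \<phi> chart_curve_dom[OF that]] by simp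
next
  fix \<psi> t assume \<psi>: "\<psi> \<in> A" and t: "t \<in> J" and "(inv_coord \<phi> \<circ> a) t \<in> dom_chart \<psi>"
  then have dom: "inv_coord \<phi> (a t) \<in> dom_chart \<psi>" by simp
  let ?\<tau> = "transition \<phi> \<psi>" and ?x = "a t"
  have x: "?x \<in> coord \<phi> ` (dom_chart \<phi> \<inter> dom_chart \<psi>)" by (rule chart_curve_overlap[OF t dom])
  note lin = linear_dir_deriv[OF smooth_transition[OF \<phi> \<psi>] x]
  have "dir_deriv (\<Gamma> \<phi> ?x (a' t) (Y t)) ?\<tau> ?x = dir_deriv (a' t) (dir_deriv (Y t) ?\<tau>) ?x
      + \<Gamma> \<psi> (?\<tau> ?x) (dir_deriv (a' t) ?\<tau> ?x) (dir_deriv (Y t) ?\<tau> ?x)"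
    using \<Gamma> \<phi> \<psi> x unfolding affine_connection_def Let_def dir_deriv_def[abs_def] by blast
  then have e: "dir_deriv (- \<Gamma> \<phi> ?x (a' t) (Y t)) ?\<tau> ?x + dir_deriv (a' t) (dir_deriv (Y t) ?\<tau>) ?x
      = - \<Gamma> \<psi> (?\<tau> ?x) (dir_deriv (a' t) ?\<tau> ?x) (dir_deriv (Y t) ?\<tau> ?x)"
    using linear_neg[OF lin, of "\<Gamma> \<phi> ?x (a' t) (Y t)"] by simp
  have "((\<lambda>s. dir_deriv (Y s) ?\<tau> (a s)) has_vector_derivative
      - \<Gamma> \<psi> (?\<tau> ?x) (dir_deriv (a' t) ?\<tau> ?x) (dir_deriv (Y t) ?\<tau> ?x)) (at t)"
    using dir_deriv_moving[OF open_overlap[OF \<phi> \<psi>] smooth_transition[OF \<phi> \<psi>] x a'[OF t] Y[OF t]]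
    unfolding e .
  then have d: "((\<lambda>s. tvec_of A \<phi> (inv_coord \<phi> (a s)) (Y s) \<psi>) has_vector_derivative
      - \<Gamma> \<psi> (?\<tau> ?x) (dir_deriv (a' t) ?\<tau> ?x) (dir_deriv (Y t) ?\<tau> ?x)) (at t)"
    by (rule has_vector_derivative_transform_within_open[OF _ chart_curve_open[OF \<psi>]])
       (use t dom \<psi> in \<open>auto simp: tvec_of_def dir_deriv_def chart_curve_coord\<close>)
  have \<tau>x: "coord \<psi> (inv_coord \<phi> ?x) = ?\<tau> ?x" by (simp add: transition_def)
  show "((\<lambda>s. tvec_of A \<phi> (inv_coord \<phi> (a s)) (Y s) \<psi>) has_vector_derivative
      - \<Gamma> \<psi> (coord \<psi> ((inv_coord \<phi> \<circ> a) t)) (velocity A (inv_coord \<phi> \<circ> a) t \<psi>)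
        (tvec_of A \<phi> (inv_coord \<phi> (a t)) (Y t) \<psi>)) (at t)"
    using d \<psi> dom unfolding chart_curve_velocity[OF t a'[OF t]]
    by (simp add: tvec_of_def dir_deriv_def chart_curve_coord[OF t] \<tau>x)
qed

end

end

section \<open>The function F^2/2 of a Finsler structure in a chart\<close>

locale finsler_atlas = smooth_atlas A
  for A :: "('m::{t2_space,second_countable_topology}, 'e::euclidean_space) chart set" +
  fixes F :: "('m, 'e) finsler_fun"
  assumes finsler: "finsler_structure A F"
begin

definition energy :: "('m, 'e) chart \<Rightarrow> 'e \<times> 'e \<Rightarrow> real" where
  "energy \<phi> = (\<lambda>(x, y). (F (inv_coord \<phi> x) (tvec_of A \<phi> (inv_coord \<phi> x) y))\<^sup>2 / 2)"

lemma smooth_energy: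
  assumes "\<phi> \<in> A" shows "smooth_on ((coord \<phi> ` dom_chart \<phi>) \<times> (UNIV - {0})) (energy \<phi>)"
proof -
  let ?O = "(coord \<phi> ` dom_chart \<phi>) \<times> (UNIV - {0::'e})"
  let ?f = "\<lambda>(x, y). F (inv_coord \<phi> x) (tvec_of A \<phi> (inv_coord \<phi> x) y)"
  have O: "open ?O" using chart(2)[OF assms] by (intro open_Times open_Diff) auto
  have f: "smooth_on ?O ?f" using finsler assms unfolding finsler_structure_def by blast
  have "smooth_on ?O (\<lambda>z. (1 / 2) *\<^sub>R (?f z *\<^sub>R ?f z))"
    by (intro smooth_on_scaleR O f smooth_on_const)
  then show ?thesis
    by (rule smooth_on_cong[OF O, rotated]) (auto simp: energy_def power2_eq_square)
qed

lemma energy_scale: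
  assumes "\<phi> \<in> A" "x \<in> coord \<phi> ` dom_chart \<phi>" "0 < l"
  shows "energy \<phi> (x, l *\<^sub>R y) = l\<^sup>2 * energy \<phi> (x, y)"
proof -
  let ?p = "inv_coord \<phi> x"
  have p: "?p \<in> dom_chart \<phi>" using assms by auto
  have "tvec_of A \<phi> ?p (l *\<^sub>R y) = (\<lambda>\<psi>. l *\<^sub>R tvec_of A \<phi> ?p y \<psi>)"
    using linear_scale[OF linear_tvec_of[OF assms(1) p]] by blast
  moreover have "F ?p (\<lambda>\<psi>. l *\<^sub>R tvec_of A \<phi> ?p y \<psi>) = l * F ?p (tvec_of A \<phi> ?p y)"
    using finsler assms(3) tvec_of_tangent[OF assms(1) p] unfolding finsler_structure_def by blast
  ultimately show ?thesis by (simp add: energy_def power_mult_distrib)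
qed

lemma fundamental_tensor_energy:
  assumes \<phi>: "\<phi> \<in> A" and x: "x \<in> coord \<phi> ` dom_chart \<phi>" and y: "y \<noteq> 0"
  shows "fundamental_tensor F (inv_coord \<phi> x) (tvec_of A \<phi> (inv_coord \<phi> x) y)
      (tvec_of A \<phi> (inv_coord \<phi> x) u) (tvec_of A \<phi> (inv_coord \<phi> x) w)
    = dir_deriv (0, u) (dir_deriv (0, w) (energy \<phi>)) (x, y)"
proof -
  let ?p = "inv_coord \<phi> x" and ?O = "(coord \<phi> ` dom_chart \<phi>) \<times> (UNIV - {0::'e})"
  have p: "?p \<in> dom_chart \<phi>" using \<phi> x by auto
  have "(\<lambda>\<psi>. tvec_of A \<phi> ?p y \<psi> + s *\<^sub>R tvec_of A \<phi> ?p u \<psi> + t *\<^sub>R tvec_of A \<phi> ?p w \<psi>)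
      = tvec_of A \<phi> ?p (y + s *\<^sub>R u + t *\<^sub>R w)" for s t
    by (rule ext)
       (simp only: linear_add[OF linear_tvec_of[OF \<phi> p]] linear_scale[OF linear_tvec_of[OF \<phi> p]])
  then have e: "fundamental_tensor F ?p (tvec_of A \<phi> ?p y) (tvec_of A \<phi> ?p u) (tvec_of A \<phi> ?p w)
      = deriv (\<lambda>s. deriv (\<lambda>t. energy \<phi> ((x, y + s *\<^sub>R u) + t *\<^sub>R (0, w))) 0) 0"
    by (simp add: fundamental_tensor_def energy_def)
  \<comment> \<open>The inner derivative is computed only where y + s u is nonzero; these
    \<open>s\<close> form a neighbourhood of 0, which is enough for the outer derivative at
    0.\<close>
  have inner: "deriv (\<lambda>t. energy \<phi> ((x, y + s *\<^sub>R u) + t *\<^sub>R (0, w))) 0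
      = dir_deriv (0, w) (energy \<phi>) ((x, y) + s *\<^sub>R (0, u))" if "y + s *\<^sub>R u \<noteq> 0" for s
  proof -
    have "((\<lambda>t. energy \<phi> ((x, y + s *\<^sub>R u) + t *\<^sub>R (0, w))) has_vector_derivative
        dir_deriv (0, w) (energy \<phi>) (x, y + s *\<^sub>R u)) (at 0)"
      using dir_deriv_line[OF smooth_energy[OF \<phi>], of "(x, y + s *\<^sub>R u)" 0 "(0, w)"] that x by simp
    then show ?thesis
      by (simp add: DERIV_imp_deriv has_real_derivative_iff_has_vector_derivative)
  qed
  have "((\<lambda>s. dir_deriv (0, w) (energy \<phi>) ((x, y) + s *\<^sub>R (0, u))) has_vector_derivative
      dir_deriv (0, u) (dir_deriv (0, w) (energy \<phi>)) (x, y)) (at 0)"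
    using dir_deriv_line[OF smooth_on_dir_deriv[OF smooth_energy[OF \<phi>]], of "(x, y)" 0 "(0, u)"] x y by simp
  then have "((\<lambda>s. deriv (\<lambda>t. energy \<phi> ((x, y + s *\<^sub>R u) + t *\<^sub>R (0, w))) 0) has_vector_derivative
      dir_deriv (0, u) (dir_deriv (0, w) (energy \<phi>)) (x, y)) (at 0)"
    by (rule has_vector_derivative_transform_within_open[OF _ open_line_nonzero[OF y, of u]])
       (rule inner[symmetric], simp)
  then show ?thesis
    unfolding e by (simp add: DERIV_imp_deriv has_real_derivative_iff_has_vector_derivative)
qed

lemma energy_pos:
  assumes "\<phi> \<in> A" "x \<in> coord \<phi> ` dom_chart \<phi>" "y \<noteq> 0" "u \<noteq> 0"
  shows "0 < dir_deriv (0, u) (dir_deriv (0, u) (energy \<phi>)) (x, y)"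
proof -
  let ?p = "inv_coord \<phi> x"
  have p: "?p \<in> dom_chart \<phi>" using assms by auto
  have "tvec_of A \<phi> ?p w \<in> tangent_space A ?p - {zero_tvec}" if "w \<noteq> 0" for w
    using tvec_of_tangent[OF assms(1) p, of w] tvec_of_eq_zero[OF assms(1) p] that assms(1) p by auto
  then have "0 < fundamental_tensor F ?p (tvec_of A \<phi> ?p y) (tvec_of A \<phi> ?p u) (tvec_of A \<phi> ?p u)"
    using finsler assms(3,4) unfolding finsler_structure_def by blast
  then show ?thesis unfolding fundamental_tensor_energy[OF assms(1-3)] .
qed

text \<open>Infinitesimal form of the invariance of \<open>F\<close>. Solving for base point and
  vector together gives an autonomous system; its solution through (x, y) is a curve of constant
  coordinate velocity \<open>u\<close> carrying a parallel field. The energy is constant along it,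
  and the claim is its derivative at time 0.\<close>

lemma energy_parallel:
  assumes \<Gamma>: "is_induced_connection A F \<Gamma>" and \<phi>: "\<phi> \<in> A"
    and x: "x \<in> coord \<phi> ` dom_chart \<phi>" and y: "y \<noteq> 0"
  shows "dir_deriv (u, - \<Gamma> \<phi> x u y) (energy \<phi>) (x, y) = 0"
proof -
  let ?S = "coord \<phi> ` dom_chart \<phi>"
  have conn: "affine_connection A \<Gamma>" and pres: "parallel_transport_preserves A \<Gamma> F"
    using \<Gamma> unfolding is_induced_connection_def by auto
  have bil: "bilinear (\<Gamma> \<phi> x)" if "x \<in> ?S" for x
    using conn \<phi> that unfolding affine_connection_def by blast
  have smooth: "smooth_on ?S (\<lambda>x. \<Gamma> \<phi> x u w)" for w
    using conn \<phi> unfolding affine_connection_def by blast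
  have O: "open (?S \<times> (UNIV :: 'e set))" using chart(2)[OF \<phi>] by (intro open_Times) auto
  let ?W = "\<lambda>z. (u, - \<Gamma> \<phi> (fst z) u (snd z))"
  \<comment> \<open>Smoothness of the symbols is assumed for fixed arguments only; linearity in the
    second argument lets the moving vector be expanded in the basis.\<close>
  have "smooth_on (?S \<times> UNIV) (\<lambda>z. (u, - (\<Sum>b\<in>Basis. (snd z \<bullet> b) *\<^sub>R \<Gamma> \<phi> (fst z) u b)))"
    by (intro smooth_on_Pair O smooth_on_const smooth_on_bounded_linear[OF bounded_linear_minus[OF bounded_linear_ident]]
        smooth_on_sum smooth_on_scaleR smooth_on_comp[OF O chart(2)[OF \<phi>] _ smooth]
        smooth_on_linear bounded_linear_fst bounded_linear_snd
        bounded_linear_compose[OF bounded_linear_inner_left bounded_linear_snd]) auto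
  then have W: "smooth_on (?S \<times> UNIV) ?W"
  proof (rule smooth_on_cong[OF O, rotated])
    fix z :: "'e \<times> 'e" assume "z \<in> ?S \<times> UNIV"
    then have "linear (\<Gamma> \<phi> (fst z) u)" using bil unfolding bilinear_def by auto
    from linear_basis_expansion[OF this, of "snd z"]
    show "(u, - (\<Sum>b\<in>Basis. (snd z \<bullet> b) *\<^sub>R \<Gamma> \<phi> (fst z) u b)) = ?W z" by simp
  qed
  obtain e c where e: "0 < e" and c0: "c 0 = (x, y)"
    and c: "\<And>t. t \<in> {-e<..<e} \<Longrightarrow> c t \<in> ?S \<times> UNIV \<and> (c has_vector_derivative ?W (c t)) (at t)"
    using picard_lindeloef[OF O W, of "(x, y)"] x by (metis SigmaI UNIV_I)
  define J where "J = {-e<..<e}"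
  define a where "a = (\<lambda>t. fst (c t))"
  define Y where "Y = (\<lambda>t. snd (c t))"
  have J: "open J" "is_interval J" "0 \<in> J" using e by (auto simp: J_def is_interval_oo)
  note c = c[folded J_def]
  have a': "(a has_vector_derivative u) (at t)" if "t \<in> J" for t
    using bounded_linear.has_vector_derivative[OF bounded_linear_fst, of c "?W (c t)" "at t"] c[OF that] by (simp add: a_def)
  have Y': "(Y has_vector_derivative - \<Gamma> \<phi> (a t) u (Y t)) (at t)" if "t \<in> J" for t
    using bounded_linear.has_vector_derivative[OF bounded_linear_snd, of c "?W (c t)" "at t"] c[OF that]
    by (simp add: a_def Y_def)
  have smooth_a: "smooth_on J a"
    unfolding a_def
    by (rule smooth_on_bounded_linear[OF bounded_linear_fst J(1) smooth_on_solution[OF O W J(1) c]])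
  have aS: "a t \<in> ?S" if "t \<in> J" for t using c[OF that] by (auto simp: a_def)
  have "smooth_curve A J (inv_coord \<phi> \<circ> a)"
    by (rule chart_curve_smooth[OF \<phi> J(1) smooth_a aS])
  moreover have "parallel_along A \<Gamma> J (inv_coord \<phi> \<circ> a) (\<lambda>t. tvec_of A \<phi> (inv_coord \<phi> (a t)) (Y t))"
    by (rule chart_curve_parallel[OF \<phi> J(1) smooth_a aS conn a' Y'])
  ultimately have "F (inv_coord \<phi> (a t)) (tvec_of A \<phi> (inv_coord \<phi> (a t)) (Y t))
      = F (inv_coord \<phi> (a 0)) (tvec_of A \<phi> (inv_coord \<phi> (a 0)) (Y 0))" if "t \<in> J" for t
    using pres J that unfolding parallel_transport_preserves_def o_def by blast
  then have const: "energy \<phi> (c 0) = energy \<phi> (c t)" if "t \<in> J" for t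
    using that by (simp add: energy_def a_def Y_def case_prod_beta)
  have "((\<lambda>t. energy \<phi> (c t)) has_vector_derivative dir_deriv (?W (c 0)) (energy \<phi>) (c 0)) (at 0)"
    using c[OF J(3)] x y c0 by (intro dir_deriv_curve[OF smooth_energy[OF \<phi>]]) auto
  moreover have "((\<lambda>t. energy \<phi> (c t)) has_vector_derivative 0) (at 0)"
    by (rule has_vector_derivative_transform_within_open[OF has_vector_derivative_const J(1,3) const])
  ultimately have "dir_deriv (?W (c 0)) (energy \<phi>) (c 0) = 0" by (rule vector_derivative_unique_at)
  then show ?thesis by (simp add: c0)
qed

lemma berwald_chart_energy:
  assumes \<Gamma>: "is_induced_connection A F \<Gamma>" and \<phi>: "\<phi> \<in> A"
  shows "berwald_chart (coord \<phi> ` dom_chart \<phi>) (energy \<phi>) (\<Gamma> \<phi>)"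
proof
  have conn: "affine_connection A \<Gamma>" and tf: "torsion_free A \<Gamma>"
    using \<Gamma> unfolding is_induced_connection_def by auto
  show "bilinear (\<Gamma> \<phi> x)" if "x \<in> coord \<phi> ` dom_chart \<phi>" for x
    using conn \<phi> that unfolding affine_connection_def by blast
  show "smooth_on (coord \<phi> ` dom_chart \<phi>) (\<lambda>x. \<Gamma> \<phi> x u w)" for u w
    using conn \<phi> unfolding affine_connection_def by blast
  show "\<Gamma> \<phi> x u w = \<Gamma> \<phi> x w u" if "x \<in> coord \<phi> ` dom_chart \<phi>" for x u w
    using tf \<phi> that unfolding torsion_free_def by blast
qed (use assms chart(2) smooth_energy energy_scale energy_pos energy_parallel in auto)

lemma induced_connection_unique:
  assumes "is_induced_connection A F \<Gamma>" "is_induced_connection A F \<Gamma>'"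
  shows "\<Gamma> = \<Gamma>'"
proof (intro ext)
  fix \<phi> x u w
  show "\<Gamma> \<phi> x u w = \<Gamma>' \<phi> x u w"
  proof (cases "\<phi> \<in> A \<and> x \<in> coord \<phi> ` dom_chart \<phi>")
    case True
    then show ?thesis
      using berwald_chart_unique[OF berwald_chart_energy berwald_chart_energy] assms by blast
  next
    \<comment> \<open>Outside the coordinate domains both connections are 0 by the last clause of
      \<open>affine_connection\<close>, so they agree as functions.\<close>
    case False
    then show ?thesis
      using assms unfolding is_induced_connection_def affine_connection_def by metis
  qed
qed

end

section \<open>Geodesic extensions and the Ricci curvature of a Berwald space\<close>

locale berwald_atlas =
  fixes A :: "('m::{t2_space,second_countable_topology}, 'e::euclidean_space) chart set"
    and F :: "('m, 'e) finsler_fun"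
  assumes berwald: "berwald_space A F"
begin

sublocale finsler_atlas A F
  using berwald by unfold_locales (simp_all add: berwald_space_def)

lemma induced_connection: "is_induced_connection A F (induced_connection A F)"
proof -
  have "\<exists>!\<Gamma>. is_induced_connection A F \<Gamma>"
    using berwald induced_connection_unique unfolding berwald_space_def by blast
  then show ?thesis unfolding induced_connection_def by (rule theI')
qed

context
  fixes p v U V
  assumes extension: "geodesic_extension A F p v U V"
begin

lemma extension_facts:
  shows "open U" "p \<in> U" "V p = v" "\<And>q. q \<in> U \<Longrightarrow> V q \<in> tangent_space A q"
    "\<And>q. q \<in> U \<Longrightarrow> V q \<noteq> zero_tvec"
    "\<And>\<phi>. \<phi> \<in> A \<Longrightarrow> smooth_on (coord \<phi> ` (U \<inter> dom_chart \<phi>)) (\<lambda>x. V (inv_coord \<phi> x) \<phi>)"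
  using extension unfolding geodesic_extension_def smooth_vector_field_def by blast+

text \<open>The geodesic equation is known only along integral curves, so one is constructed through
  the given point by solving the equation for \<open>W\<close> in the chart. Its velocity is the
  field itself, and the chain rule turns the equation at time 0 into the pointwise identity.\<close>

lemma extension_geodesic:
  assumes \<phi>: "\<phi> \<in> A" and x: "x \<in> coord \<phi> ` (U \<inter> dom_chart \<phi>)"
  defines "W \<equiv> \<lambda>x. V (inv_coord \<phi> x) \<phi>"
  shows "dir_deriv (W x) W x + induced_connection A F \<phi> x (W x) (W x) = 0"
proof -
  let ?S = "coord \<phi> ` (U \<inter> dom_chart \<phi>)" and ?\<Gamma> = "induced_connection A F"
  have O: "open ?S" by (rule open_coord_image[OF \<phi> extension_facts(1)])
  have W: "smooth_on ?S W" unfolding W_def by (rule extension_facts(6)[OF \<phi>])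
  obtain e a where e: "0 < e" and a0: "a 0 = x"
    and a: "\<And>t. t \<in> {-e<..<e} \<Longrightarrow> a t \<in> ?S \<and> (a has_vector_derivative W (a t)) (at t)"
    using picard_lindeloef[OF O W x] by metis
  define J where "J = {-e<..<e}"
  have J: "open J" "is_interval J" "0 \<in> J" using e by (auto simp: J_def is_interval_oo)
  note a = a[folded J_def]
  let ?c = "inv_coord \<phi> \<circ> a"
  have smooth_a: "smooth_on J a" by (rule smooth_on_solution[OF O W J(1) a])
  have aS: "a t \<in> coord \<phi> ` dom_chart \<phi>" if "t \<in> J" for t using a[OF that] by auto
  have cU: "?c t \<in> U" "?c t \<in> dom_chart \<phi>" if "t \<in> J" for t
    using a[OF that] \<phi> by auto
  have vel: "velocity A ?c t = V (?c t)" if "t \<in> J" for t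
  proof -
    have "velocity A ?c t = tvec_of A \<phi> (?c t) (W (a t))"
      using chart_curve_velocity[OF \<phi> J(1) smooth_a aS that] a[OF that] by simp
    also have "\<dots> = V (?c t)"
      using tvec_of_component[OF \<phi> cU(2)[OF that] extension_facts(4)[OF cU(1)[OF that]]]
      by (simp add: W_def)
    finally show ?thesis .
  qed
  have "integral_curve A V J ?c"
    unfolding integral_curve_def using chart_curve_smooth[OF \<phi> J(1) smooth_a aS] vel by blast
  moreover have "?c ` J \<subseteq> U" using cU by blast
  ultimately have "geodesic A ?\<Gamma> J ?c"
    using extension J unfolding geodesic_extension_def by blast
  then have "((\<lambda>s. velocity A ?c s \<phi>) has_vector_derivative
      - ?\<Gamma> \<phi> (coord \<phi> (?c 0)) (velocity A ?c 0 \<phi>) (velocity A ?c 0 \<phi>)) (at 0)"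
    unfolding geodesic_def parallel_along_def using \<phi> J(3) cU(2) by blast
  moreover have "coord \<phi> (?c 0) = x" using \<phi> aS[OF J(3)] a0 by simp
  moreover have "velocity A ?c 0 \<phi> = W x" using vel[OF J(3)] a0 by (simp add: W_def)
  ultimately have "((\<lambda>s. velocity A ?c s \<phi>) has_vector_derivative - ?\<Gamma> \<phi> x (W x) (W x)) (at 0)"
    by simp
  then have "((\<lambda>s. W (a s)) has_vector_derivative - ?\<Gamma> \<phi> x (W x) (W x)) (at 0)"
    by (rule has_vector_derivative_transform_within_open[OF _ J(1,3)]) (simp add: vel W_def)
  moreover have "((\<lambda>s. W (a s)) has_vector_derivative dir_deriv (W (a 0)) W (a 0)) (at 0)"
    using a[OF J(3)] by (intro dir_deriv_curve[OF W]) auto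
  ultimately have "dir_deriv (W (a 0)) W (a 0) = - ?\<Gamma> \<phi> x (W x) (W x)"
    by (metis vector_derivative_unique_at)
  then show ?thesis by (simp add: a0)
qed

lemma curvature_extension:
  assumes \<phi>: "\<phi> \<in> A" and p: "p \<in> dom_chart \<phi>"
  shows "curvature (levi_civita A (\<lambda>q. fundamental_tensor F q (V q))) \<phi> (coord \<phi> p) u (v \<phi>) (v \<phi>)
    = curvature (induced_connection A F) \<phi> (coord \<phi> p) u (v \<phi>) (v \<phi>)"
proof -
  let ?S = "coord \<phi> ` (U \<inter> dom_chart \<phi>)" and ?\<Gamma> = "induced_connection A F"
  let ?G = "metric_in_chart A (\<lambda>q. fundamental_tensor F q (V q)) \<phi>"
  let ?C = "levi_civita A (\<lambda>q. fundamental_tensor F q (V q)) \<phi>"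
  define W where "W = (\<lambda>x. V (inv_coord \<phi> x) \<phi>)"
  have O: "open ?S" by (rule open_coord_image[OF \<phi> extension_facts(1)])
  have inv: "inv_coord \<phi> z \<in> U" "inv_coord \<phi> z \<in> dom_chart \<phi>" if "z \<in> ?S" for z
    using that \<phi> by auto
  have tvec: "tvec_of A \<phi> (inv_coord \<phi> z) (W z) = V (inv_coord \<phi> z)" if "z \<in> ?S" for z
    unfolding W_def using inv[OF that] by (intro tvec_of_component[OF \<phi>] extension_facts(4))
  have nz: "W z \<noteq> 0" if "z \<in> ?S" for z
    using extension_facts(5)[OF inv(1)[OF that]] inv[OF that]
      tvec_of_eq_zero[OF \<phi> inv(2)[OF that] extension_facts(4)] by (simp add: W_def)
  interpret berwald_chart ?S "energy \<phi>" "?\<Gamma> \<phi>"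
    by (rule berwald_chart_subset[OF berwald_chart_energy[OF induced_connection \<phi>] O]) auto
  interpret berwald_field ?S "energy \<phi>" "?\<Gamma> \<phi>" W
    using extension_facts(6)[OF \<phi>] extension_geodesic[OF \<phi>] nz
    by unfold_locales (simp_all add: W_def)
  have G: "?G z a b = g z a b" if "z \<in> ?S" for z a b
  proof -
    have "z \<in> coord \<phi> ` dom_chart \<phi>" using that by auto
    from fundamental_tensor_energy[OF \<phi> this nz[OF that], of a b] show ?thesis
      by (simp only: metric_in_chart_def Let_def g_def H_def tvec[OF that])
  qed
  have dG: "frechet_derivative (\<lambda>z. ?G z a b) (at z) c = dir_deriv c (\<lambda>z. g z a b) z"
    if "z \<in> ?S" for z a b c
  proof -
    have "(\<lambda>z. g z a b) differentiable at z"
      using smooth_on_has_dir_deriv[OF smooth_g that] by (rule differentiableI)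
    from dir_deriv_cong[OF O that _ this, of "\<lambda>z. ?G z a b"] show ?thesis
      by (simp add: dir_deriv_def G)
  qed
  have "2 * g z (?C z a b) y = koszul z a b y" if "z \<in> ?S" for z a b y
  proof -
    \<comment> \<open>The Christoffel symbols are a definite description; over \<open>?S\<close> its
      metric and derivatives are those of \<open>g\<close>, so \<open>levi_civita_ex1\<close>
      supplies the defining equation.\<close>
    have "?C z a b = (THE q. \<forall>y. 2 * g z q y = koszul z a b y)"
      unfolding levi_civita_def Let_def by (simp only: G[OF that] dG[OF that])
    with theI'[OF levi_civita_ex1[OF that, of a b]] show ?thesis by simp
  qed
  then interpret berwald_levi_civita ?S "energy \<phi>" "?\<Gamma> \<phi>" W ?C
    by unfold_locales
  have "coord \<phi> p \<in> ?S" using p extension_facts(2) by auto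
  moreover have "v \<phi> = W (coord \<phi> p)" using \<phi> p extension_facts(3) by (simp add: W_def)
  ultimately show ?thesis
    using curvature_V[of "coord \<phi> p" "v \<phi>" u] by (simp add: curvature_def dir_deriv_def)
qed

text \<open>\<open>curvature_extension\<close> matches the summands of the trace in each chart
  around \<open>p\<close>, so both definite descriptions have the same predicate.\<close>

lemma ricci_tensor_extension:
  "ricci_tensor A (levi_civita A (\<lambda>q. fundamental_tensor F q (V q))) p v v
    = ricci_tensor A (induced_connection A F) p v v"
  unfolding ricci_tensor_def
  by (intro arg_cong[where f=The] ext ex_cong1 conj_cong bex_cong refl) (simp add: curvature_extension)

end

text \<open>The metric of the extension has disappeared from the value \<open>r\<close>. On the
  right, \<open>F\<close> occurs only through \<open>induced_connection A F\<close>, inside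
  \<open>geodesic_extension\<close> as well, so affinely equivalent structures give the same
  expression.\<close>

lemma ricci_curvature_induced:
  "ricci_curvature A F p v = (if v = zero_tvec then 0
    else THE r. \<exists>U V. geodesic_extension A F p v U V \<and> r = ricci_tensor A (induced_connection A F) p v v)"
  unfolding ricci_curvature_def
  by (intro if_cong refl arg_cong[where f=The] ext ex_cong1 conj_cong) (simp add: ricci_tensor_extension)

end

theorem theorem13:
  fixes A :: "('m::{t2_space,second_countable_topology}, 'e::euclidean_space) chart set"
    and F F' :: "('m, 'e) finsler_fun"
  assumes "berwald_space A F"
    and "berwald_space A F'"
    and "affinely_equivalent A F F'"
  shows "(\<forall>p. \<forall>v\<in>tangent_space A p. ricci_curvature A F p v = ricci_curvature A F' p v)
    \<and> (nonneg_ricci A F \<longleftrightarrow> nonneg_ricci A F')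
    \<and> (nonpos_ricci A F \<longleftrightarrow> nonpos_ricci A F')"
proof -
  interpret F: berwald_atlas A F by unfold_locales fact
  interpret F': berwald_atlas A F' by unfold_locales fact
  have "ricci_curvature A F p v = ricci_curvature A F' p v" for p v
    using assms(3)
    unfolding F.ricci_curvature_induced F'.ricci_curvature_induced
      geodesic_extension_def affinely_equivalent_def by simp
  then show ?thesis by (simp add: nonneg_ricci_def nonpos_ricci_def)
qed

end
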